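(* Let $X$ be either $S^3$ or $\mathbb{R}\mathrm{P}^3$ and let $f:X\to S^2$ be a map. If $f$ is not null-homotopic, then $\mathrm{rank}\big(\check{H}^1(f^{-1}(y_0))\big)\geq1$.
   Context: "Map" means continuous map. $\check{H}^1$ denotes first Čech cohomology with integer coefficients, and the rank of an abelian group is the maximal number of $\mathbb{Z}$-linearly independent elements (possibly infinite). The base point is $y_0=h(1,0)\in S^2$, where $h:S^3\to S^2$ is the Hopf fibration: $S^3=\{(z_1,z_2)\in\mathbb{C}^2 : |z_1|^2+|z_2|^2=1\}$ with the circle action $(\lambda,(z_1,z_2))\mapsto(\lambda z_1,\lambda z_2)$, $S^3/S^1=\mathbb{C}\mathrm{P}^1$ is identified with $S^2$, and $h$ sends each point to the class of its orbit. *)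

theory Defs
  imports "HOL-Analysis.Analysis" "HOL-Algebra.Coset" "HOL-Algebra.FiniteProduct"
    "HOL-Library.Extended_Nat"
begin

section \<open>The spaces and the Hopf fibration\<close>

definition null_homotopic :: "'a topology \<Rightarrow> 'b topology \<Rightarrow> ('a \<Rightarrow> 'b) \<Rightarrow> bool" where
  "null_homotopic X Y f \<longleftrightarrow> (\<exists>c. homotopic_with (\<lambda>_. True) X Y f (\<lambda>_. c))"

definition quotient_topology :: "'a topology \<Rightarrow> ('a \<Rightarrow> 'b) \<Rightarrow> 'b topology" where
  "quotient_topology X q =
     topology (\<lambda>V. V \<subseteq> q ` topspace X \<and> openin X {x \<in> topspace X. q x \<in> V})"

lemma openin_quotient_topology:
  "openin (quotient_topology X q) V \<longleftrightarrow>
     V \<subseteq> q ` topspace X \<and> openin X {x \<in> topspace X. q x \<in> V}"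
proof -
  define pre where "pre V = {x \<in> topspace X. q x \<in> V}" for V
  have "pre (S \<inter> T) = pre S \<inter> pre T" for S T
    by (auto simp: pre_def)
  moreover have "pre (\<Union>\<K>) = \<Union>(pre ` \<K>)" for \<K>
    by (auto simp: pre_def)
  ultimately have "istopology (\<lambda>V. V \<subseteq> q ` topspace X \<and> openin X (pre V))"
    by (auto simp: istopology_def)
  then show ?thesis by (simp add: quotient_topology_def topology_inverse' pre_def)
qed

lemma topspace_quotient_topology [simp]: "topspace (quotient_topology X q) = q ` topspace X"
proof (rule subset_antisym)
  show "topspace (quotient_topology X q) \<subseteq> q ` topspace X"
    using openin_topspace[of "quotient_topology X q"]
    unfolding openin_quotient_topology by (rule conjunct1)
  have "{x \<in> topspace X. q x \<in> q ` topspace X} = topspace X" by blast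
  then have "openin (quotient_topology X q) (q ` topspace X)"
    by (simp add: openin_quotient_topology)
  then show "q ` topspace X \<subseteq> topspace (quotient_topology X q)"
    by (rule openin_subset)
qed

lemma quotient_map_quotient_topology: "quotient_map X (quotient_topology X q) q"
  by (auto simp: quotient_map_def openin_quotient_topology)

text \<open>
  The norm on \<^typ>\<open>complex \<times> complex\<close> and on \<^typ>\<open>complex \<times> real\<close> is the Euclidean one, so these
  are the unit spheres of \<open>C^2 = R^4\<close> and \<open>C \<times> R = R^3\<close>.
\<close>

abbreviation S3 :: "(complex \<times> complex) topology" where
  "S3 \<equiv> top_of_set (sphere 0 1)"

abbreviation S2 :: "(complex \<times> real) topology" where
  "S2 \<equiv> top_of_set (sphere 0 1)"

definition RP3 :: "(complex \<times> complex) set topology" where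
  "RP3 = quotient_topology S3 (\<lambda>p. {p, - p})"

text \<open>
  The identification of the orbit space \<open>S^3/S^1 = CP^1\<close> with \<open>S^2\<close> is the usual one, under which
  the orbit map is given by the formula below. Lemmas \<open>hopf_eq_iff\<close> and \<open>quotient_map_hopf\<close>
  confirm that \<open>hopf\<close> is a quotient map whose fibres are exactly the circle orbits.
\<close>

definition hopf :: "complex \<times> complex \<Rightarrow> complex \<times> real" where
  "hopf p = (2 * fst p * cnj (snd p), (cmod (fst p))\<^sup>2 - (cmod (snd p))\<^sup>2)"

lemma norm_hopf: "norm (hopf p) = (norm p)\<^sup>2"
proof -
  have "(norm (hopf p))\<^sup>2 = ((norm p)\<^sup>2)\<^sup>2"
    by (simp add: hopf_def norm_prod_def norm_mult power2_eq_square algebra_simps)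
  then show ?thesis
    using power2_eq_iff_nonneg[of "norm (hopf p)" "(norm p)\<^sup>2"] by simp
qed

lemma hopf_eq_iff:
  assumes "p \<in> sphere 0 1" "q \<in> sphere 0 1"
  shows "hopf p = hopf q \<longleftrightarrow> (\<exists>l. cmod l = 1 \<and> q = (l * fst p, l * snd p))"
proof -
  obtain a b c d where p: "p = (a, b)" and q: "q = (c, d)" by fastforce
  have ab: "(cmod a)\<^sup>2 + (cmod b)\<^sup>2 = 1" and cd: "(cmod c)\<^sup>2 + (cmod d)\<^sup>2 = 1"
    using assms by (auto simp: p q norm_prod_def)
  show ?thesis
  proof
    assume "hopf p = hopf q"
    then have prod: "a * cnj b = c * cnj d"
      and diff: "(cmod a)\<^sup>2 - (cmod b)\<^sup>2 = (cmod c)\<^sup>2 - (cmod d)\<^sup>2"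
      by (auto simp: hopf_def p q)
    have "(cmod a)\<^sup>2 = (cmod c)\<^sup>2" "(cmod b)\<^sup>2 = (cmod d)\<^sup>2"
      using ab cd diff by linarith+
    then have ac: "cmod a = cmod c" and bd: "cmod b = cmod d"
      by simp_all
    show "\<exists>l. cmod l = 1 \<and> q = (l * fst p, l * snd p)"
    proof (cases "a = 0")
      case True
      then have "c = 0" "b \<noteq> 0" using ac ab by auto
      then show ?thesis using True bd
        by (intro exI[of _ "d / b"]) (auto simp: p q norm_divide)
    next
      case False
      then have c: "c \<noteq> 0" using ac by auto
      have sq: "a * cnj a = c * cnj c"
        using ac by (simp flip: complex_norm_square)
      have "cnj a * b = cnj c * d"
        using arg_cong[OF prod, of cnj] by simp
      then have "(c * cnj c) * (a * d) = (c * cnj c) * (c * b)"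
        using sq by algebra
      then have "a * d = c * b" using c by simp
      then show ?thesis using False ac
        by (intro exI[of _ "c / a"]) (auto simp: p q norm_divide field_simps)
    qed
  next
    assume "\<exists>l. cmod l = 1 \<and> q = (l * fst p, l * snd p)"
    then obtain l where l: "cmod l = 1" and cd': "c = l * a" "d = l * b"
      by (auto simp: p q)
    have "l * cnj l = 1" using l by (simp flip: complex_norm_square)
    then have "c * cnj d = a * cnj b"
      unfolding cd' complex_cnj_mult by algebra
    then show "hopf p = hopf q"
      by (simp add: hopf_def p q cd' l norm_mult)
  qed
qed

lemma quotient_map_hopf: "quotient_map S3 S2 hopf"
proof (rule continuous_imp_quotient_map)
  have "continuous_on (sphere 0 1) hopf"
    unfolding hopf_def by (intro continuous_intros)
  moreover have img: "hopf ` sphere 0 1 \<subseteq> sphere 0 1"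
    by (auto simp: norm_hopf)
  ultimately show "continuous_map S3 S2 hopf" by auto
  have "y \<in> hopf ` sphere 0 1" if "y \<in> sphere 0 1" for y
  proof -
    obtain u t where y: "y = (u, t)" by fastforce
    have ut: "(cmod u)\<^sup>2 + t\<^sup>2 = 1" using that by (auto simp: y norm_prod_def)
    then have "t\<^sup>2 \<le> 1" by (smt (verit) zero_le_power2)
    then have t: "\<bar>t\<bar> \<le> 1" by (simp add: abs_square_le_1)
    show ?thesis
    proof (cases "t = - 1")
      case True
      then have "u = 0" using ut by simp
      then have "hopf (0, 1) = y" using True by (simp add: hopf_def y)
      then show ?thesis by (auto simp: norm_prod_def intro!: image_eqI[of _ _ "(0, 1)"])
    next
      case False
      define r where "r = sqrt ((1 + t) / 2)"
      have r2: "r\<^sup>2 = (1 + t) / 2" and r: "r > 0"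
        using t False by (auto simp: r_def)
      define p where "p = (of_real r :: complex, cnj u / (2 * of_real r))"
      have "(cmod u)\<^sup>2 = ((1 - t) / 2) * (4 * r\<^sup>2)"
        unfolding r2 using ut by (simp add: power2_eq_square field_simps)
      moreover have "(cmod (snd p))\<^sup>2 = (cmod u)\<^sup>2 / (4 * r\<^sup>2)"
        using r by (simp add: p_def norm_divide norm_mult power_divide power_mult_distrib)
      ultimately have b2: "(cmod (snd p))\<^sup>2 = (1 - t) / 2" using r by simp
      have "norm p = 1"
        using b2 r r2 by (simp add: norm_prod_def) (simp add: p_def r2 field_simps)
      moreover have "hopf p = y"
        using b2 r r2 by (simp add: hopf_def y) (simp add: p_def r2 field_simps)
      ultimately show ?thesis by (auto intro!: image_eqI[of _ _ p])
    qed
  qed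
  then show "hopf ` topspace S3 = topspace S2" using img by auto
  show "compact_space S3" by (simp add: compact_space_subtopology)
  show "Hausdorff_space S2" by (rule Hausdorff_space_subtopology) simp
qed


section \<open>Rank of an abelian group\<close>

definition int_independent :: "('a, 'b) monoid_scheme \<Rightarrow> 'a set \<Rightarrow> bool" where
  "int_independent G S \<longleftrightarrow> S \<subseteq> carrier G \<and>
     (\<forall>F n. finite F \<and> F \<subseteq> S \<and> finprod G (\<lambda>x. x [^]\<^bsub>G\<^esub> (n x :: int)) F = \<one>\<^bsub>G\<^esub>
        \<longrightarrow> (\<forall>x\<in>F. n x = 0))"

definition ab_rank :: "('a, 'b) monoid_scheme \<Rightarrow> enat" where
  "ab_rank G = (SUP S \<in> {S. finite S \<and> int_independent G S}. enat (card S))"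


section \<open>Direct limits of groups\<close>

text \<open>
  \<open>I\<close> is preordered and directed by \<open>below\<close>, and \<open>\<rho> i k : G i \<rightarrow> G k\<close> for \<open>below i k\<close> are the transition
  homomorphisms. Elements of the limit are equivalence classes in the disjoint union of the \<open>G i\<close>.
\<close>

definition direct_limit_rel ::
  "'i set \<Rightarrow> ('i \<Rightarrow> 'i \<Rightarrow> bool) \<Rightarrow> ('i \<Rightarrow> 'g monoid) \<Rightarrow> ('i \<Rightarrow> 'i \<Rightarrow> 'g \<Rightarrow> 'g)
     \<Rightarrow> (('i \<times> 'g) \<times> ('i \<times> 'g)) set" where
  "direct_limit_rel I below G \<rho> =
     {((i, x), (j, y)). i \<in> I \<and> x \<in> carrier (G i) \<and> j \<in> I \<and> y \<in> carrier (G j) \<and>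
        (\<exists>k\<in>I. below i k \<and> below j k \<and> \<rho> i k x = \<rho> j k y)}"

definition direct_limit ::
  "'i set \<Rightarrow> ('i \<Rightarrow> 'i \<Rightarrow> bool) \<Rightarrow> ('i \<Rightarrow> 'g monoid) \<Rightarrow> ('i \<Rightarrow> 'i \<Rightarrow> 'g \<Rightarrow> 'g)
     \<Rightarrow> ('i \<times> 'g) set monoid" where
  "direct_limit I below G \<rho> =
     \<lparr> carrier = (SIGMA i:I. carrier (G i)) // direct_limit_rel I below G \<rho>,
       mult = (\<lambda>A B. \<Union>(i, x)\<in>A. \<Union>(j, y)\<in>B. \<Union>k\<in>{k\<in>I. below i k \<and> below j k}.
                 direct_limit_rel I below G \<rho> `` {(k, \<rho> i k x \<otimes>\<^bsub>G k\<^esub> \<rho> j k y)}),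
       one = (\<Union>i\<in>I. direct_limit_rel I below G \<rho> `` {(i, \<one>\<^bsub>G i\<^esub>)}) \<rparr>"


section \<open>Cech cohomology with integer coefficients\<close>

text \<open>
  Covers are indexed by themselves, and simplices of the nerve are ordered: tuples of members of
  the cover, repetitions allowed, whose intersection is nonempty. A cochain is extended by zero to
  the lists that are not simplices.
\<close>

definition open_covers :: "'a topology \<Rightarrow> 'a set set set" where
  "open_covers X = {\<U>. (\<forall>U\<in>\<U>. openin X U) \<and> \<Union>\<U> = topspace X}"

definition nerve :: "nat \<Rightarrow> 'a set set \<Rightarrow> 'a set list set" where
  "nerve n \<U> = {\<sigma>. length \<sigma> = Suc n \<and> set \<sigma> \<subseteq> \<U> \<and> \<Inter>(set \<sigma>) \<noteq> {}}"

definition cochains :: "nat \<Rightarrow> 'a set set \<Rightarrow> ('a set list \<Rightarrow> int) monoid" where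
  "cochains n \<U> =
     \<lparr> carrier = {c. \<forall>\<sigma>. \<sigma> \<notin> nerve n \<U> \<longrightarrow> c \<sigma> = 0},
       mult = (\<lambda>c d \<sigma>. c \<sigma> + d \<sigma>),
       one = (\<lambda>_. 0) \<rparr>"

definition coboundary ::
  "nat \<Rightarrow> 'a set set \<Rightarrow> ('a set list \<Rightarrow> int) \<Rightarrow> 'a set list \<Rightarrow> int" where
  "coboundary n \<U> c \<sigma> =
     (if \<sigma> \<in> nerve (Suc n) \<U>
      then \<Sum>i\<le>Suc n. (- 1) ^ i * c (take i \<sigma> @ drop (Suc i) \<sigma>) else 0)"

definition cocycles :: "nat \<Rightarrow> 'a set set \<Rightarrow> ('a set list \<Rightarrow> int) set" where
  "cocycles n \<U> = kernel (cochains n \<U>) (cochains (Suc n) \<U>) (coboundary n \<U>)"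

definition coboundaries :: "nat \<Rightarrow> 'a set set \<Rightarrow> ('a set list \<Rightarrow> int) set" where
  "coboundaries n \<U> =
     (case n of 0 \<Rightarrow> {\<one>\<^bsub>cochains 0 \<U>\<^esub>}
      | Suc m \<Rightarrow> coboundary m \<U> ` carrier (cochains m \<U>))"

definition nerve_cohomology :: "nat \<Rightarrow> 'a set set \<Rightarrow> ('a set list \<Rightarrow> int) set monoid" where
  "nerve_cohomology n \<U> =
     ((cochains n \<U>) \<lparr> carrier := cocycles n \<U> \<rparr>) Mod (coboundaries n \<U>)"

definition refined_by :: "'a set set \<Rightarrow> 'a set set \<Rightarrow> bool" where
  "refined_by \<U> \<V> \<longleftrightarrow> (\<forall>V\<in>\<V>. \<exists>U\<in>\<U>. V \<subseteq> U)"

definition refinement_maps :: "'a set set \<Rightarrow> 'a set set \<Rightarrow> ('a set \<Rightarrow> 'a set) set" where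
  "refinement_maps \<U> \<V> = {p. \<forall>V\<in>\<V>. p V \<in> \<U> \<and> V \<subseteq> p V}"

definition cochain_pullback ::
  "nat \<Rightarrow> 'a set set \<Rightarrow> ('a set \<Rightarrow> 'a set) \<Rightarrow> ('a set list \<Rightarrow> int) \<Rightarrow> 'a set list \<Rightarrow> int" where
  "cochain_pullback n \<V> p c \<sigma> = (if \<sigma> \<in> nerve n \<V> then c (map p \<sigma>) else 0)"

text \<open>
  All representatives \<open>c\<close> of a class \<open>A\<close> and all refinement maps \<open>p\<close> give the same coset, since
  different refinement maps are contiguous; the union below is therefore that single coset.
\<close>

definition refinement_hom ::
  "nat \<Rightarrow> 'a set set \<Rightarrow> 'a set set \<Rightarrow> ('a set list \<Rightarrow> int) set \<Rightarrow> ('a set list \<Rightarrow> int) set" where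
  "refinement_hom n \<U> \<V> A =
     (\<Union>c\<in>A. \<Union>p\<in>refinement_maps \<U> \<V>.
        coboundaries n \<V> #>\<^bsub>cochains n \<V>\<^esub> cochain_pullback n \<V> p c)"

definition cech_cohomology ::
  "nat \<Rightarrow> 'a topology \<Rightarrow> ('a set set \<times> ('a set list \<Rightarrow> int) set) set monoid" where
  "cech_cohomology n X =
     direct_limit (open_covers X) refined_by (nerve_cohomology n) (refinement_hom n)"

end

theory Submission
  imports Defs
begin

text \<open>
  If the first Cech cohomology of the fibre \<open>K\<close> over the base point has rank zero, every map from
  \<open>K\<close> to the circle has a continuous logarithm. On \<open>S^3\<close> the map \<open>f\<close> factors as \<open>h \<circ> g\<close> through the
  Hopf fibration, and \<open>g\<close> maps \<open>K\<close> into the circle over the base point. Extending a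
  logarithm of \<open>g\<close> on \<open>K\<close> to the whole space and rotating \<open>g\<close> along the fibres by it, one may assume
  that \<open>g\<close> maps \<open>K\<close> to the single point \<open>(1, 0)\<close>. Then \<open>g\<close> is not surjective, so \<open>f\<close> is null-homotopic.

  For \<open>RP^3\<close>, the lift \<open>g\<close> of the composition of \<open>f\<close> with the double covering can be chosen even
  or odd. If it is even, the same argument applies. If it is odd, rotating \<open>g\<close> by half of a logarithm of its square on \<open>K\<close>
  yields an odd map from \<open>S^3\<close> to \<open>S^2\<close>, contradicting the Borsuk-Ulam theorem.
\<close>

section \<open>Lifting maps through the Hopf fibration\<close>

text \<open>Rank zero only says that every class is torsion, whereas a logarithm on the fibre
  requires the class of the circle-valued map to vanish. The gap closes because a potential for
  \<open>m\<close> times an integral cocycle has increments divisible by \<open>m\<close>, so it can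
  be divided by \<open>m\<close> with rounding.

  For \<open>RP3\<close> the obstacle is that the hypothesis concerns a fibre in the quotient, so
  only even functions on its preimage in the sphere receive logarithms. If \<open>g\<close> is odd,
  its first component is not even but its square is. Half of the logarithm of the square determines
  the rotation only up to sign: the fibre goes to the pair \<open>(1, 0)\<close>,
  \<open>(- 1, 0)\<close> instead of one point. This still frees an antipodal pair of points on the
  circle, which is what an equivariant push into S^2 needs.\<close>

lemma hopf_scaleR: "hopf (c *\<^sub>R p) = c\<^sup>2 *\<^sub>R hopf p"
  by (simp add: hopf_def scaleR_conv_of_real norm_mult power_mult_distrib algebra_simps power2_eq_square)

lemma hopf_base: "hopf (1, 0) = (0, 1)"
  by (simp add: hopf_def)

lemma hopf_eq_base_iff:
  assumes "norm p = 1"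
  shows "hopf p = (0, 1) \<longleftrightarrow> snd p = 0"
proof -
  have "(cmod (fst p))\<^sup>2 + (cmod (snd p))\<^sup>2 = 1"
    using assms by (simp add: norm_prod_def)
  then show ?thesis by (auto simp: hopf_def)
qed

lemma continuous_on_hopf [continuous_intros]:
  "continuous_on S g \<Longrightarrow> continuous_on S (\<lambda>x. hopf (g x))"
  unfolding hopf_def by (intro continuous_intros)

text \<open>
  Under the usual identification of \<open>S^2\<close> with the rank one projections of \<open>C^2\<close>,
  \<open>hopf_proj y\<close> is twice the projection onto the line \<open>y\<close>.
\<close>

definition hopf_proj :: "complex \<times> real \<Rightarrow> complex \<times> complex \<Rightarrow> complex \<times> complex" where
  "hopf_proj y p = (of_real (1 + snd y) * fst p + fst y * snd p,
                    cnj (fst y) * fst p + of_real (1 - snd y) * snd p)"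

text \<open>As a matrix, \<open>hopf_proj y\<close> is the identity plus the traceless Hermitian
  matrix of \<open>y\<close>. For a unit vector \<open>y\<close> its square is twice itself, so the
  squared norm of the image of \<open>p\<close> is twice the Hermitian form at \<open>p\<close>,
  which is the bracket on the right.\<close>

lemma norm_hopf_proj:
  assumes "norm y = 1"
  shows "(norm (hopf_proj y p))\<^sup>2 = 2 * ((norm p)\<^sup>2 + y \<bullet> hopf p)"
proof -
  obtain u t a b where [simp]: "y = (u, t)" "p = (a, b)" by fastforce
  have ut: "(Re u)\<^sup>2 + (Im u)\<^sup>2 + t\<^sup>2 = 1"
    using assms by (simp add: norm_prod_def cmod_power2)
  show ?thesis
    by (simp add: hopf_proj_def hopf_def norm_prod_def cmod_power2 inner_complex_def)
       (use ut in algebra)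
qed

lemma hopf_hopf_proj:
  assumes "norm y = 1"
  shows "hopf (hopf_proj y p) = (norm (hopf_proj y p))\<^sup>2 *\<^sub>R y"
proof -
  obtain u t a b where [simp]: "y = (u, t)" "p = (a, b)" by fastforce
  have ut: "(Re u)\<^sup>2 + (Im u)\<^sup>2 + t\<^sup>2 = 1"
    using assms by (simp add: norm_prod_def cmod_power2)
  show ?thesis
    unfolding norm_hopf_proj[OF assms]
    by (simp add: hopf_proj_def hopf_def norm_prod_def cmod_power2 inner_complex_def complex_eq_iff)
       (intro conjI; use ut in algebra)
qed

text \<open>The kernel of the projection is the orthogonal line, whose point on S^2 is antipodal.
  Quantitatively, \<open>y + hopf p\<close> and the image of \<open>p\<close> have equal
  norms.\<close>

lemma hopf_proj_eq_0_iff: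
  assumes "norm y = 1" "norm p = 1"
  shows "hopf_proj y p = 0 \<longleftrightarrow> y = - hopf p"
proof -
  have "norm (hopf p) = 1" using assms by (simp add: norm_hopf)
  then have "(norm (y + hopf p))\<^sup>2 = 2 * (1 + y \<bullet> hopf p)"
    using assms by (simp add: power2_norm_eq_inner inner_add inner_commute norm_eq_1)
  then have "(norm (y + hopf p))\<^sup>2 = (norm (hopf_proj y p))\<^sup>2"
    using norm_hopf_proj[OF assms(1), of p] assms by simp
  then show ?thesis
    by (metis add_eq_0_iff2 norm_eq_zero power_eq_0_iff zero_less_numeral zero_neq_numeral)
qed

definition hopf_lifts :: "'a::topological_space set \<Rightarrow> ('a \<Rightarrow> complex \<times> real) \<Rightarrow> bool" where
  "hopf_lifts S f \<longleftrightarrow>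
     (\<exists>g. continuous_on S g \<and> (\<forall>x\<in>S. norm (g x) = 1 \<and> hopf (g x) = f x))"

text \<open>Projecting the lift of \<open>f'\<close> onto the line \<open>f x\<close> and
  normalising gives a lift of \<open>f\<close>. The only obstacle is a lift orthogonal to that line,
  which \<open>near\<close> excludes.\<close>

lemma hopf_lifts_near:
  assumes f: "continuous_on S f" "\<And>x. x \<in> S \<Longrightarrow> norm (f x) = 1"
    and f': "hopf_lifts S f'" and near: "\<And>x. x \<in> S \<Longrightarrow> f x \<noteq> - f' x"
  shows "hopf_lifts S f"
proof -
  obtain g where g: "continuous_on S g" "\<And>x. x \<in> S \<Longrightarrow> norm (g x) = 1"
    "\<And>x. x \<in> S \<Longrightarrow> hopf (g x) = f' x"
    using f' unfolding hopf_lifts_def by blast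
  define k where "k x = hopf_proj (f x) (g x)" for x
  have k0: "k x \<noteq> 0" if "x \<in> S" for x
    using that f(2) g near hopf_proj_eq_0_iff by (metis k_def)
  have k: "continuous_on S k"
    unfolding k_def hopf_proj_def by (intro continuous_intros f g)
  have "continuous_on S (\<lambda>x. inverse (norm (k x)) *\<^sub>R k x)"
    by (intro continuous_intros k) (use k0 in auto)
  moreover have "norm (inverse (norm (k x)) *\<^sub>R k x) = 1 \<and>
      hopf (inverse (norm (k x)) *\<^sub>R k x) = f x" if "x \<in> S" for x
    using k0[OF that] f(2)[OF that]
    by (simp add: hopf_scaleR k_def hopf_hopf_proj power_inverse)
  ultimately show ?thesis unfolding hopf_lifts_def by blast
qed

lemma hopf_lifts_const:
  assumes "norm y = 1"
  shows "hopf_lifts S (\<lambda>_. y)"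
proof -
  have "y \<in> hopf ` sphere 0 1"
    using quotient_imp_surjective_map[OF quotient_map_hopf] assms by simp
  then obtain p where "norm p = 1" "hopf p = y" by auto
  then show ?thesis
    unfolding hopf_lifts_def by (intro exI[of _ "\<lambda>_. p"]) simp
qed

text \<open>The lift is transported along the contraction of the ball to its centre in small steps.\<close>

lemma hopf_lifts_cball:
  fixes f :: "'a::euclidean_space \<Rightarrow> complex \<times> real"
  assumes f: "continuous_on (cball 0 1) f" "\<And>x. x \<in> cball 0 1 \<Longrightarrow> norm (f x) = 1"
  shows "hopf_lifts (cball 0 1) f"
proof -
  have "uniformly_continuous_on (cball 0 1) f"
    using f(1) by (intro compact_uniformly_continuous) auto
  \<comment> \<open>Antipodal unit vectors have distance exactly 2, so arguments closer than
    \<open>d\<close> have images that are not antipodal.\<close>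
  then obtain d where d: "d > 0"
    "\<And>x y. x \<in> cball 0 1 \<Longrightarrow> y \<in> cball 0 1 \<Longrightarrow> dist x y < d \<Longrightarrow> dist (f x) (f y) < 2"
    unfolding uniformly_continuous_on_def by (metis zero_less_numeral)
  obtain N :: nat where N: "N > 0" "inverse (real N) < d"
    using ex_inverse_of_nat_less[OF d(1)] by blast
  define s where "s k x = (real k / real N) *\<^sub>R x" for k and x :: 'a
  have s: "s k x \<in> cball 0 1" if "k \<le> N" "x \<in> cball 0 1" for k x
  proof -
    have "real k / real N * norm x \<le> 1 * 1"
      using that N by (intro mult_mono) auto
    then show ?thesis by (simp add: s_def)
  qed
  have "hopf_lifts (cball 0 1) (\<lambda>x. f (s k x))" if "k \<le> N" for k
    using that
  proof (induction k)
    case 0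
    then show ?case using hopf_lifts_const f(2)[of 0] by (simp add: s_def)
  next
    case (Suc k)
    have fs: "norm (f (s j x)) = 1" if "j \<le> N" "x \<in> cball 0 1" for j x
      using that s f(2) by blast
    have neq: "f (s (Suc k) x) \<noteq> - f (s k x)" if x: "x \<in> cball 0 1" for x
    proof
      assume eq: "f (s (Suc k) x) = - f (s k x)"
      have "s (Suc k) x - s k x = inverse (real N) *\<^sub>R x"
        by (simp add: s_def add_divide_distrib inverse_eq_divide flip: scaleR_left_diff_distrib)
      then have "dist (s (Suc k) x) (s k x) \<le> inverse (real N) * 1"
        using x unfolding dist_norm by (simp add: mult_left_le)
      then have "dist (f (s (Suc k) x)) (f (s k x)) < 2"
        using d(2) s Suc.prems x N by auto
      moreover have "dist (f (s (Suc k) x)) (f (s k x)) = norm (2 *\<^sub>R f (s k x))"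
        unfolding eq dist_norm by (metis norm_minus_cancel minus_diff_eq diff_minus_eq_add scaleR_2)
      ultimately show False
        using fs[of k x] Suc.prems x by simp
    qed
    have cont: "continuous_on (cball 0 1) (\<lambda>x. f (s (Suc k) x))"
    proof (rule continuous_on_compose2[OF f(1)])
      show "continuous_on (cball 0 1) (s (Suc k))"
        unfolding s_def by (intro continuous_intros)
    qed (use s Suc.prems in auto)
    show ?case
      by (rule hopf_lifts_near[OF cont fs[OF Suc.prems] Suc.IH[OF Suc_leD[OF Suc.prems]] neq])
  qed
  from this[of N] N show ?thesis by (simp add: s_def)
qed

text \<open>In an ambient space of dimension at least three the sphere is simply connected, so a
  complex logarithm exists; modulus one kills its real part.\<close>

lemma continuous_circle_log_sphere:
  fixes f :: "'a::euclidean_space \<Rightarrow> complex"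
  assumes "3 \<le> DIM('a)" "continuous_on (sphere 0 1) f" "\<And>x. x \<in> sphere 0 1 \<Longrightarrow> cmod (f x) = 1"
  obtains \<theta> where "continuous_on (sphere 0 1) \<theta>" "\<And>x. x \<in> sphere 0 1 \<Longrightarrow> f x = cis (\<theta> x)"
proof -
  have "f x \<noteq> 0" if "x \<in> sphere 0 1" for x using assms(3)[OF that] by auto
  then obtain g where g: "continuous_on (sphere 0 1) g" "\<And>x. x \<in> sphere 0 1 \<Longrightarrow> f x = exp (g x)"
    using continuous_logarithm_on_simply_connected[OF assms(2) simply_connected_sphere[OF assms(1)]]
      locally_path_connected_sphere by metis
  show ?thesis
  proof
    show "continuous_on (sphere 0 1) (\<lambda>x. Im (g x))" by (intro continuous_intros g)
    fix x :: 'a assume x: "x \<in> sphere 0 1"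
    have "exp (Re (g x)) = 1" using assms(3)[OF x] g(2)[OF x] by simp
    then show "f x = cis (Im (g x))" using g(2)[OF x] by (simp add: exp_eq_polar)
  qed
qed

text \<open>
  \<open>S^3\<close> is the union of two hemispheres, each a graph over the unit ball of \<open>C \<times> R\<close>. Over each of
  them there is a lift; on the common boundary sphere they differ by a map to the circle, which extends over the ball
  because it has a logarithm.
\<close>

lemma hopf_lifts_S3:
  assumes f: "continuous_on (sphere 0 1) f" "\<And>x. x \<in> sphere 0 1 \<Longrightarrow> norm (f x) = 1"
  shows "hopf_lifts (sphere 0 1 :: (complex \<times> complex) set) f"
proof -
  let ?B = "cball 0 1 :: (complex \<times> real) set"
  let ?S = "sphere 0 1 :: (complex \<times> real) set"
  \<comment> \<open>For \<open>c = 1\<close> and \<open>c = -1\<close> these are the hemispheres on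
    which the imaginary part of the second coordinate is nonnegative or nonpositive;
    \<open>pr\<close> forgets that coordinate.\<close>
  define e where "e c v = (fst v, Complex (snd v) (c * sqrt (1 - (norm v)\<^sup>2)))"
    for c :: real and v :: "complex \<times> real"
  define pr where "pr p = (fst p, Re (snd p))" for p :: "complex \<times> complex"
  have e: "continuous_on ?B (e c)" for c
    unfolding e_def Complex_eq by (intro continuous_intros)
  have e1: "norm (e c v) = 1" if "v \<in> ?B" "c\<^sup>2 = 1" for c v
  proof -
    have "1 - (norm v)\<^sup>2 \<ge> 0" using that by (simp add: power_le_one)
    then show ?thesis using that(2)
      by (simp add: e_def norm_prod_def cmod_power2 power_mult_distrib)
  qed
  have pr: "pr p \<in> ?B" "(norm (pr p))\<^sup>2 = 1 - (Im (snd p))\<^sup>2" if "norm p = 1" for p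
  proof -
    show *: "(norm (pr p))\<^sup>2 = 1 - (Im (snd p))\<^sup>2"
      using that by (simp add: pr_def norm_prod_def cmod_power2)
    then have "(norm (pr p))\<^sup>2 \<le> 1" by simp
    then show "pr p \<in> ?B" by (simp add: power2_le_imp_le abs_square_le_1)
  qed
  have epr: "e c (pr p) = p" if "norm p = 1" "c * \<bar>Im (snd p)\<bar> = Im (snd p)" for p c
    using that pr(2)[OF that(1)] by (simp add: e_def) (simp add: pr_def)
  have lift: "\<exists>g. continuous_on ?B g \<and> (\<forall>v\<in>?B. norm (g v) = 1 \<and> hopf (g v) = f (e c v))"
    if "c\<^sup>2 = 1" for c
    unfolding hopf_lifts_def[symmetric]
  proof (rule hopf_lifts_cball)
    show "continuous_on ?B (\<lambda>v. f (e c v))"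
      by (rule continuous_on_compose2[OF f(1) e]) (use e1 that in auto)
  qed (use f(2) e1 that in auto)
  obtain g where g: "continuous_on ?B g" "\<And>v. v \<in> ?B \<Longrightarrow> norm (g v) = 1"
    "\<And>v. v \<in> ?B \<Longrightarrow> hopf (g v) = f (e 1 v)" using lift[of 1] by auto
  obtain h where h: "continuous_on ?B h" "\<And>v. v \<in> ?B \<Longrightarrow> norm (h v) = 1"
    "\<And>v. v \<in> ?B \<Longrightarrow> hopf (h v) = f (e (-1) v)" using lift[of "-1"] by auto
  \<comment> \<open>Where \<open>g v\<close> is a scalar times the unit vector \<open>h v\<close>,
    the Hermitian product recovers the scalar, continuously in \<open>v\<close>.\<close>
  define s where "s v = fst (g v) * cnj (fst (h v)) + snd (g v) * cnj (snd (h v))" for v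
  have s: "cmod (s v) = 1 \<and> g v = (s v * fst (h v), s v * snd (h v))" if v: "v \<in> ?S" for v
  proof -
    have v': "v \<in> ?B" using v by auto
    have "e 1 v = e (-1) v" using v by (simp add: e_def)
    then have "hopf (h v) = hopf (g v)" using g h v' by simp
    then obtain l where l: "cmod l = 1" "g v = (l * fst (h v), l * snd (h v))"
      using hopf_eq_iff[of "h v" "g v"] g h v' by auto
    have "(cmod (fst (h v)))\<^sup>2 + (cmod (snd (h v)))\<^sup>2 = 1"
      using h(2)[OF v'] by (simp add: norm_prod_def)
    then have "fst (h v) * cnj (fst (h v)) + snd (h v) * cnj (snd (h v)) = 1"
      by (metis complex_norm_square of_real_1 of_real_add)
    then have "s v = l" unfolding s_def l by (simp add: algebra_simps flip: distrib_left)
    then show ?thesis using l by simp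
  qed
  have "continuous_on ?S s"
    unfolding s_def
    by (intro continuous_intros continuous_on_subset[OF g(1)] continuous_on_subset[OF h(1)]) auto
  then obtain \<theta> where \<theta>: "continuous_on ?S \<theta>" "\<And>v. v \<in> ?S \<Longrightarrow> s v = cis (\<theta> v)"
    using continuous_circle_log_sphere[of s] s by auto
  obtain \<theta>' where \<theta>': "continuous_on UNIV \<theta>'" "\<And>v. v \<in> ?S \<Longrightarrow> \<theta>' v = \<theta> v"
    using Tietze_unbounded[OF \<theta>(1), of UNIV] by (auto simp: closed_closedin[symmetric])
  define k where "k v = (cis (\<theta>' v) * fst (h v), cis (\<theta>' v) * snd (h v))" for v
  have k: "continuous_on ?B k"
    unfolding k_def
    by (intro continuous_intros h continuous_on_subset[OF \<theta>'(1)]) auto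
  have k': "norm (k v) = 1 \<and> hopf (k v) = f (e (-1) v)" if "v \<in> ?B" for v
  proof -
    have *: "norm (k v) = 1" using h(2)[OF that] by (simp add: k_def norm_prod_def norm_mult)
    then have "hopf (h v) = hopf (k v)"
      by (subst hopf_eq_iff) (use h(2)[OF that] in \<open>auto simp: k_def intro!: exI[of _ "cis (\<theta>' v)"]\<close>)
    then show ?thesis using h(3)[OF that] * by simp
  qed
  have gk: "g v = k v" if "v \<in> ?S" for v
    using s[OF that] \<theta>(2)[OF that] \<theta>'(2)[OF that] by (simp add: k_def)
  let ?U = "sphere 0 1 \<inter> {p :: complex \<times> complex. Im (snd p) \<ge> 0}"
  let ?L = "sphere 0 1 \<inter> {p :: complex \<times> complex. Im (snd p) \<le> 0}"
  define G where "G p = (if Im (snd p) \<ge> 0 then g (pr p) else k (pr p))" for p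
  have prc: "continuous_on A pr" for A
    unfolding pr_def by (intro continuous_intros)
  have "continuous_on (?U \<union> ?L) G"
    unfolding G_def
  proof (rule continuous_on_cases)
    show "closed ?U" "closed ?L"
      by (intro closed_Int closed_sphere closed_Collect_le continuous_intros)+
    show "continuous_on ?U (\<lambda>p. g (pr p))" "continuous_on ?L (\<lambda>p. k (pr p))"
      by (rule continuous_on_compose2[OF g(1) prc] continuous_on_compose2[OF k prc]; use pr in auto)+
    show "\<forall>p. p \<in> ?U \<and> \<not> 0 \<le> Im (snd p) \<or> p \<in> ?L \<and> 0 \<le> Im (snd p) \<longrightarrow> g (pr p) = k (pr p)"
    proof (intro allI impI)
      fix p assume "p \<in> ?U \<and> \<not> 0 \<le> Im (snd p) \<or> p \<in> ?L \<and> 0 \<le> Im (snd p)"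
      then have "norm p = 1" "Im (snd p) = 0" by auto
      then have "pr p \<in> ?S" using pr(2)[of p] by (simp add: power2_eq_1_iff) (use norm_ge_zero[of "pr p"] in linarith)
      then show "g (pr p) = k (pr p)" by (rule gk)
    qed
  qed
  moreover have "?U \<union> ?L = sphere 0 1" by auto
  moreover have "norm (G p) = 1 \<and> hopf (G p) = f p" if "p \<in> sphere 0 1" for p
    using that g k' pr(1)[of p] epr[of p 1] epr[of p "-1"] by (auto simp: G_def)
  ultimately show ?thesis unfolding hopf_lifts_def by auto
qed

section \<open>Odd maps and null-homotopic maps\<close>

text \<open>Antipodal points correspond to orthogonal lines, so \<open>p\<close> and
  \<open>q\<close> are the columns of a unitary matrix.\<close>

lemma cmod_det_antipodal:
  assumes "norm p = 1" "norm q = 1" "hopf q = - hopf p"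
  shows "cmod (fst p * snd q - snd p * fst q) = 1"
proof -
  \<comment> \<open>The squared moduli of the Hermitian product and of the determinant add up to the
    product of the squared norms; the inner product of the Hopf images is twice the first of them
    minus this product.\<close>
  have id: "2 * (cmod (fst p * snd q - snd p * fst q))\<^sup>2 = (norm p)\<^sup>2 * (norm q)\<^sup>2 - hopf p \<bullet> hopf q"
    by (simp add: hopf_def norm_prod_def cmod_power2 inner_complex_def inner_prod_def)
       (simp add: power2_eq_square algebra_simps)
  have "hopf p \<bullet> hopf q = - ((norm (hopf p))\<^sup>2)"
    by (simp add: assms power2_norm_eq_inner)
  then have "(cmod (fst p * snd q - snd p * fst q))\<^sup>2 = 1"
    using id assms by (simp add: norm_hopf)
  then show ?thesis by (simp add: power2_eq_1_iff) (metis norm_ge_zero neg_0_le_iff_le not_one_le_zero)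
qed

text \<open>The sphere is connected, and \<open>d\<close> takes some value together with its
  negative.\<close>

lemma odd_function_on_sphere_has_zero:
  fixes d :: "'a::euclidean_space \<Rightarrow> real"
  assumes "2 \<le> DIM('a)" "continuous_on (sphere 0 1) d"
    and odd: "\<And>x. x \<in> sphere 0 1 \<Longrightarrow> d (- x) = - d x"
  obtains x where "x \<in> sphere 0 1" "d x = 0"
proof -
  obtain b :: 'a where b: "b \<in> sphere 0 1" using vector_choose_size[of 1] by auto
  have conn: "connected (d ` sphere 0 1)"
    using assms(1,2) connected_sphere by (intro connected_continuous_image) auto
  have *: "d b \<in> d ` sphere 0 1" "- d b \<in> d ` sphere 0 1"
    using b odd[OF b] by (auto intro: image_eqI[of _ _ "- b"])
  have "0 \<in> d ` sphere 0 1"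
  proof (cases "d b \<ge> 0")
    case True
    then show ?thesis using connectedD_interval[OF conn *(2,1), of 0] by simp
  next
    case False
    then show ?thesis using connectedD_interval[OF conn *, of 0] by simp
  qed
  then show thesis using that by force
qed

lemma continuous_on_sphere_uminus:
  fixes h :: "'a::real_normed_vector \<Rightarrow> 'b::topological_space"
  shows "continuous_on (sphere 0 1) h \<Longrightarrow> continuous_on (sphere 0 1) (\<lambda>x. h (- x))"
  by (erule continuous_on_compose2) (auto intro: continuous_intros)

text \<open>
  A case of the Borsuk-Ulam theorem. Lifting \<open>F\<close> through the Hopf fibration to \<open>g\<close>, the vectors \<open>g x\<close> and
  \<open>g (- x)\<close> are orthogonal, so their determinant is an odd map from \<open>S^3\<close> to the circle; but a map
  to the circle that has a logarithm cannot be odd.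
\<close>

lemma no_odd_map_S3_S2:
  fixes F :: "complex \<times> complex \<Rightarrow> complex \<times> real"
  assumes F: "continuous_on (sphere 0 1) F" "\<And>x. x \<in> sphere 0 1 \<Longrightarrow> norm (F x) = 1"
    and odd: "\<And>x. x \<in> sphere 0 1 \<Longrightarrow> F (- x) = - F x"
  shows False
proof -
  obtain g where g: "continuous_on (sphere 0 1) g" "\<And>x. x \<in> sphere 0 1 \<Longrightarrow> norm (g x) = 1"
    "\<And>x. x \<in> sphere 0 1 \<Longrightarrow> hopf (g x) = F x"
    using hopf_lifts_S3[OF F] unfolding hopf_lifts_def by blast
  define s where "s x = fst (g x) * snd (g (- x)) - snd (g x) * fst (g (- x))" for x
  have g': "continuous_on (sphere 0 1) (\<lambda>x. g (- x))"
    by (rule continuous_on_sphere_uminus[OF g(1)])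
  have "continuous_on (sphere 0 1) s"
    unfolding s_def by (intro continuous_intros g(1) g')
  moreover have "cmod (s x) = 1" if "x \<in> sphere 0 1" for x
    unfolding s_def by (rule cmod_det_antipodal) (use that g odd in auto)
  ultimately obtain \<theta> where \<theta>: "continuous_on (sphere 0 1) \<theta>"
    "\<And>x. x \<in> sphere 0 1 \<Longrightarrow> s x = cis (\<theta> x)"
    using continuous_circle_log_sphere[of s] by auto
  have "continuous_on (sphere 0 1) (\<lambda>x. \<theta> (- x))"
    by (rule continuous_on_sphere_uminus[OF \<theta>(1)])
  \<comment> \<open>This real function is odd whatever \<open>\<theta>\<close> is. At a zero of it
    \<open>s\<close> agrees at antipodes, while exchanging the two columns changes the sign of the
    determinant.\<close>
  then have "continuous_on (sphere 0 1) (\<lambda>x. \<theta> (- x) - \<theta> x)"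
    by (intro continuous_intros \<theta>)
  then obtain x where x: "x \<in> sphere 0 1" "\<theta> (- x) = \<theta> x"
    by (rule odd_function_on_sphere_has_zero[rotated]) auto
  have "s (- x) = - s x" by (simp add: s_def algebra_simps)
  moreover have "s (- x) = s x" using x \<theta>(2)[of x] \<theta>(2)[of "- x"] by simp
  ultimately show False using \<theta>(2)[OF x(1)] by simp
qed

text \<open>Rotating \<open>g\<close> along the fibres by \<open>- \<phi>\<close> makes it miss the point \<open>(- 1, 0)\<close>.\<close>

lemma null_homotopic_hopf:
  assumes g: "continuous_map X S3 g" and \<phi>: "continuous_map X euclideanreal \<phi>"
    and log: "\<And>x. x \<in> topspace X \<Longrightarrow> snd (g x) = 0 \<Longrightarrow> fst (g x) = cis (\<phi> x)"
    and f: "\<And>x. x \<in> topspace X \<Longrightarrow> f x = hopf (g x)"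
  shows "null_homotopic X S2 f"
proof -
  define rot where "rot = (\<lambda>(r, p). (cis (- r) * fst p, cis (- r) * snd p))"
  define k where "k x = rot (\<phi> x, g x)" for x
  let ?P = "sphere 0 1 - {(- 1, 0)} :: (complex \<times> complex) set"
  have g1: "norm (g x) = 1" if "x \<in> topspace X" for x
    using g that by (auto simp: continuous_map_in_subtopology)
  have k1: "norm (k x) = 1" if "x \<in> topspace X" for x
    using g1[OF that] by (simp add: k_def rot_def norm_prod_def norm_mult)
  have fk: "hopf (k x) = f x" if "x \<in> topspace X" for x
  proof -
    have "hopf (g x) = hopf (k x)"
      by (subst hopf_eq_iff) (use g1 k1 that in \<open>auto simp: k_def rot_def intro!: exI[of _ "cis (- \<phi> x)"]\<close>)
    then show ?thesis using f[OF that] by simp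
  qed
  \<comment> \<open>The point lies on the circle over the base point, and there the rotation brings
    \<open>g\<close> to \<open>(1, 0)\<close>.\<close>
  have miss: "k x \<noteq> (- 1, 0)" if x: "x \<in> topspace X" for x
  proof
    assume eq: "k x = (- 1, 0)"
    then have "snd (g x) = 0" by (simp add: k_def rot_def)
    then have "fst (k x) = 1" using log[OF x] by (simp add: k_def rot_def cis_mult)
    with eq show False by simp
  qed
  have "continuous_on UNIV rot"
    unfolding rot_def case_prod_unfold by (intro continuous_intros)
  then have "continuous_map (prod_topology euclideanreal euclidean) euclidean rot"
    by simp
  moreover have "continuous_map X (prod_topology euclideanreal euclidean) (\<lambda>x. (\<phi> x, g x))"
    using \<phi> g by (intro continuous_map_pairedI) (simp_all add: continuous_map_in_subtopology)
  ultimately have "continuous_map X euclidean (rot \<circ> (\<lambda>x. (\<phi> x, g x)))"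
    by (rule continuous_map_compose[rotated])
  then have "continuous_map X euclidean k"
    by (rule continuous_map_eq) (simp add: k_def)
  then have "continuous_map X (top_of_set ?P) k"
    using k1 miss by (auto simp: continuous_map_in_subtopology)
  moreover have "continuous_map (top_of_set ?P) S2 hopf"
    using norm_hopf by (auto intro!: continuous_intros)
  \<comment> \<open>Stereographic projection from the missed point: \<open>k\<close> is
    null-homotopic before \<open>hopf\<close> is applied.\<close>
  moreover have "contractible ?P"
  proof -
    have "?P homeomorphic {x :: complex \<times> complex. (1, 0) \<bullet> x = 0}"
      by (rule homeomorphic_punctured_sphere_hyperplane) (simp_all add: norm_prod_def zero_prod_def dist_norm)
    then show ?thesis
      using homeomorphic_contractible_eq convex_imp_contractible[OF convex_hyperplane] by blast
  qed
  ultimately obtain c where "homotopic_with (\<lambda>h. True) X S2 (hopf \<circ> k) (\<lambda>x. c)"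
    using nullhomotopic_through_contractible_space[of X "top_of_set ?P" k S2 hopf] by auto
  then have "homotopic_with (\<lambda>h. True) X S2 f (\<lambda>x. c)"
    by (rule homotopic_with_eq) (auto simp: fk)
  then show ?thesis unfolding null_homotopic_def by blast
qed

section \<open>Extension of angles, and even functions on the three-sphere as functions on
  projective space\<close>

lemma Tietze_real:
  fixes \<phi> :: "'a::euclidean_space \<Rightarrow> real"
  assumes K: "closed K" and \<phi>: "continuous_on K \<phi>"
  obtains \<Phi> where "continuous_on UNIV \<Phi>" "\<And>x. x \<in> K \<Longrightarrow> \<Phi> x = \<phi> x"
  using Tietze_unbounded[OF \<phi>, of UNIV] K by (auto simp: closed_closedin[symmetric])

lemma topspace_RP3: "topspace RP3 = (\<lambda>p. {p, - p}) ` sphere 0 1"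
  by (simp add: RP3_def)

lemma continuous_map_RP3_iff:
  "continuous_map RP3 Y k \<longleftrightarrow> continuous_map S3 Y (\<lambda>p. k {p, - p})"
  using continuous_compose_quotient_map_eq[OF quotient_map_quotient_topology[of S3 "\<lambda>p. {p, - p}"], of Y k]
  by (simp add: RP3_def o_def)

text \<open>Logarithms are available only on a subset of \<open>RP3\<close>, so functions on the
  sphere have to be moved there; by evenness the choice of a representative does not matter.\<close>

lemma even_function_descends:
  fixes k :: "complex \<times> complex \<Rightarrow> 'b::topological_space"
  assumes "continuous_on (sphere 0 1) k" "\<And>x. x \<in> sphere 0 1 \<Longrightarrow> k (- x) = k x"
  obtains k' where "continuous_map RP3 euclidean k'" "\<And>x. x \<in> sphere 0 1 \<Longrightarrow> k' {x, - x} = k x"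
proof
  define k' where "k' A = k (SOME p. p \<in> A)" for A
  show k': "k' {x, - x} = k x" if "x \<in> sphere 0 1" for x
  proof -
    have "(SOME p. p \<in> {x, - x}) \<in> {x, - x}" by (rule someI[of _ x]) simp
    then show ?thesis using assms(2)[OF that] by (auto simp: k'_def)
  qed
  show "continuous_map RP3 euclidean k'"
    unfolding continuous_map_RP3_iff
    by (rule continuous_map_eq[of _ _ k]) (use assms(1) k' in auto)
qed

text \<open>
  Dividing out half of the odd part of the logarithm of the transition function \<open>s\<close> leaves a continuous sign.
\<close>

lemma hopf_lift_of_even:
  fixes F :: "complex \<times> complex \<Rightarrow> complex \<times> real"
  assumes F: "continuous_on (sphere 0 1) F" "\<And>x. x \<in> sphere 0 1 \<Longrightarrow> norm (F x) = 1"
    and even: "\<And>x. x \<in> sphere 0 1 \<Longrightarrow> F (- x) = F x"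
  obtains g where "continuous_on (sphere 0 1) g" "\<And>x. x \<in> sphere 0 1 \<Longrightarrow> norm (g x) = 1"
    "\<And>x. x \<in> sphere 0 1 \<Longrightarrow> hopf (g x) = F x"
    "(\<forall>x\<in>sphere 0 1. g (- x) = g x) \<or> (\<forall>x\<in>sphere 0 1. g (- x) = - g x)"
proof -
  let ?S = "sphere 0 1 :: (complex \<times> complex) set"
  obtain g where g: "continuous_on ?S g" "\<And>x. x \<in> ?S \<Longrightarrow> norm (g x) = 1"
    "\<And>x. x \<in> ?S \<Longrightarrow> hopf (g x) = F x"
    using hopf_lifts_S3[OF F] unfolding hopf_lifts_def by blast
  note g_neg = continuous_on_sphere_uminus[OF g(1)]
  define s where "s x = fst (g (- x)) * cnj (fst (g x)) + snd (g (- x)) * cnj (snd (g x))" for x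
  have s: "cmod (s x) = 1 \<and> g (- x) = (s x * fst (g x), s x * snd (g x))" if x: "x \<in> ?S" for x
  proof -
    have x': "- x \<in> ?S" using x by simp
    have "hopf (g x) = hopf (g (- x))" using g(3) x x' even by simp
    then obtain l where l: "cmod l = 1" "g (- x) = (l * fst (g x), l * snd (g x))"
      using hopf_eq_iff[of "g x" "g (- x)"] g x x' by auto
    have "(cmod (fst (g x)))\<^sup>2 + (cmod (snd (g x)))\<^sup>2 = 1"
      using g(2)[OF x] by (simp add: norm_prod_def)
    then have "fst (g x) * cnj (fst (g x)) + snd (g x) * cnj (snd (g x)) = 1"
      by (metis complex_norm_square of_real_1 of_real_add)
    then have "s x = l" unfolding s_def l by (simp add: algebra_simps flip: distrib_left)
    then show ?thesis using l by simp
  qed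
  \<comment> \<open>Passing to the antipode twice returns to \<open>g x\<close>, and a nonzero
    vector determines its scalar factor.\<close>
  have ss: "s (- x) * s x = 1" if x: "x \<in> ?S" for x
  proof -
    have "g x = (s (- x) * s x * fst (g x), s (- x) * s x * snd (g x))"
      using s[OF x] s[of "- x"] x by (simp add: mult.assoc)
    moreover have "g x \<noteq> 0" using g(2)[OF x] by auto
    ultimately show ?thesis
      by (metis mult_cancel_right1 prod.collapse fst_conv snd_conv zero_prod_def)
  qed
  have "continuous_on ?S s"
    unfolding s_def by (intro continuous_intros g(1) g_neg)
  then obtain \<theta> where \<theta>: "continuous_on ?S \<theta>" "\<And>x. x \<in> ?S \<Longrightarrow> s x = cis (\<theta> x)"
    using continuous_circle_log_sphere[of s] s by auto
  note \<theta>_neg = continuous_on_sphere_uminus[OF \<theta>(1)]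
  \<comment> \<open>Rotating \<open>g\<close> by an odd angle \<open>\<psi>\<close> turns the
    transition angle \<open>\<theta> x\<close> into \<open>\<theta> x - 2 * \<psi> x\<close>. With
    \<open>\<psi> x\<close> a quarter of \<open>\<theta> x - \<theta> (- x)\<close>, only the even
    part of \<open>\<theta>\<close> is left, which is the angle of
    \<open>\<epsilon>\<close>.\<close>
  define h where "h x = (cis ((\<theta> x - \<theta> (- x)) / 4) * fst (g x), cis ((\<theta> x - \<theta> (- x)) / 4) * snd (g x))" for x
  define \<epsilon> where "\<epsilon> x = cis ((\<theta> x + \<theta> (- x)) / 2)" for x
  have \<epsilon>: "\<epsilon> x = 1 \<or> \<epsilon> x = - 1" if x: "x \<in> ?S" for x
  proof -
    have "\<epsilon> x ^ 2 = s x * s (- x)"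
      using x \<theta>(2)[of x] \<theta>(2)[of "- x"] by (simp add: \<epsilon>_def cis_mult power2_eq_square)
    also have "\<dots> = 1" using ss[OF x] by (simp add: mult.commute)
    finally show ?thesis by (simp add: power2_eq_1_iff)
  qed
  have "continuous_on ?S \<epsilon>"
    unfolding \<epsilon>_def by (intro continuous_intros \<theta>(1) \<theta>_neg) simp
  moreover have "\<epsilon> ` ?S \<subseteq> {1, - 1}" using \<epsilon> by blast
  then have "finite (\<epsilon> ` ?S)" by (rule finite_subset) simp
  moreover have "connected ?S" by (rule connected_sphere) simp
  ultimately have "\<epsilon> constant_on ?S"
    by (intro continuous_finite_range_constant)
  then obtain e where e: "\<And>x. x \<in> ?S \<Longrightarrow> \<epsilon> x = e" unfolding constant_on_def by blast
  have h: "continuous_on ?S h"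
    unfolding h_def by (intro continuous_intros g(1) \<theta>(1) \<theta>_neg) auto
  have h1: "norm (h x) = 1" if "x \<in> ?S" for x
    using g(2)[OF that] by (simp add: h_def norm_prod_def norm_mult)
  have h2: "hopf (h x) = F x" if "x \<in> ?S" for x
  proof -
    have "hopf (g x) = hopf (h x)"
      by (subst hopf_eq_iff)
        (use g(2) h1 that in \<open>auto simp: h_def intro!: exI[of _ "cis ((\<theta> x - \<theta> (- x)) / 4)"]\<close>)
    then show ?thesis using g(3)[OF that] by simp
  qed
  have h3: "h (- x) = (e * fst (h x), e * snd (h x))" if x: "x \<in> ?S" for x
  proof -
    have "cis ((\<theta> (- x) - \<theta> x) / 4) * cis (\<theta> x) = \<epsilon> x * cis ((\<theta> x - \<theta> (- x)) / 4)"
      unfolding \<epsilon>_def cis_mult by (rule arg_cong[of _ _ cis]) (simp add: field_simps)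
    then have "cis ((\<theta> (- x) - \<theta> x) / 4) * s x = e * cis ((\<theta> x - \<theta> (- x)) / 4)"
      using e[OF x] \<theta>(2)[OF x] by simp
    then show ?thesis using s[OF x] by (simp add: h_def mult.assoc[symmetric])
  qed
  have "(1, 0) \<in> ?S" by (simp add: norm_prod_def)
  then have "e = 1 \<or> e = - 1" using \<epsilon>[of "(1, 0)"] e[of "(1, 0)"] by simp
  then have "(\<forall>x\<in>?S. h (- x) = h x) \<or> (\<forall>x\<in>?S. h (- x) = - h x)"
    using h3 by (auto simp: prod_eq_iff)
  then show thesis using that h h1 h2 by blast
qed

text \<open>
  If \<open>g\<close> were odd, then so would be its rotation by half of the logarithm of the square of its
  first component on the fibre; as this rotation avoids \<open>(i, 0)\<close> and \<open>(- i, 0)\<close>, it could be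
  pushed equivariantly into \<open>S^2\<close>.
\<close>

lemma no_odd_lift:
  fixes g :: "complex \<times> complex \<Rightarrow> complex \<times> complex"
  assumes g: "continuous_on (sphere 0 1) g" "\<And>x. x \<in> sphere 0 1 \<Longrightarrow> norm (g x) = 1"
    and odd: "\<And>x. x \<in> sphere 0 1 \<Longrightarrow> g (- x) = - g x"
    and \<Phi>: "continuous_on (sphere 0 1) \<Phi>" "\<And>x. x \<in> sphere 0 1 \<Longrightarrow> \<Phi> (- x) = \<Phi> x"
    and log: "\<And>x. x \<in> sphere 0 1 \<Longrightarrow> snd (g x) = 0 \<Longrightarrow> (fst (g x))\<^sup>2 = cis (\<Phi> x)"
  shows False
proof -
  let ?S = "sphere 0 1 :: (complex \<times> complex) set"
  define a where "a x = cis (- \<Phi> x / 2) * fst (g x)" for x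
  define b where "b x = cis (- \<Phi> x / 2) * snd (g x)" for x
  \<comment> \<open>The rotated map \<open>(a, b)\<close> is odd because \<open>\<Phi>\<close> is
    even. Forgetting the imaginary part of \<open>a\<close> is harmless: where \<open>b\<close> is
    zero, \<open>a\<close> is a square root of 1 and hence real.\<close>
  define q where "q x = (b x, Re (a x))" for x
  have q0: "q x \<noteq> 0" if x: "x \<in> ?S" for x
  proof
    assume "q x = 0"
    then have "snd (g x) = 0" and re: "Re (a x) = 0" by (auto simp: q_def b_def zero_prod_def)
    then have "(a x)\<^sup>2 = 1"
      using log[OF x] by (simp add: a_def power_mult_distrib cis_mult power2_eq_square[of "cis _"])
    then have "a x = 1 \<or> a x = - 1" by (simp add: power2_eq_1_iff)
    with re show False by auto
  qed
  have q: "continuous_on ?S q"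
    unfolding q_def a_def b_def by (intro continuous_intros g(1) \<Phi>(1)) simp_all
  have qodd: "q (- x) = - q x" if "x \<in> ?S" for x
    using odd[OF that] \<Phi>(2)[OF that] by (simp add: q_def a_def b_def)
  have "continuous_on ?S (\<lambda>x. sgn (q x))"
    unfolding sgn_div_norm by (intro continuous_intros q) (use q0 in auto)
  then show False
    by (rule no_odd_map_S3_S2) (use q0 qodd in \<open>auto simp: norm_sgn sgn_minus\<close>)
qed

section \<open>Direct limits of abelian groups\<close>

text \<open>These laws make the unions over representatives in \<open>direct_limit\<close> single
  classes: everything is compared in a group far enough along the directed set.\<close>

locale directed_group_system =
  fixes I :: "'i set" and below :: "'i \<Rightarrow> 'i \<Rightarrow> bool"
    and G :: "'i \<Rightarrow> 'g monoid" and \<rho> :: "'i \<Rightarrow> 'i \<Rightarrow> 'g \<Rightarrow> 'g"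
  assumes nonempty: "I \<noteq> {}"
    and below_refl: "i \<in> I \<Longrightarrow> below i i"
    and below_trans: "below i j \<Longrightarrow> below j k \<Longrightarrow> below i k"
    and directed: "i \<in> I \<Longrightarrow> j \<in> I \<Longrightarrow> \<exists>k\<in>I. below i k \<and> below j k"
    and comm_group: "i \<in> I \<Longrightarrow> comm_group (G i)"
    and hom: "i \<in> I \<Longrightarrow> j \<in> I \<Longrightarrow> below i j \<Longrightarrow> \<rho> i j \<in> hom (G i) (G j)"
    and comp: "i \<in> I \<Longrightarrow> j \<in> I \<Longrightarrow> k \<in> I \<Longrightarrow> below i j \<Longrightarrow> below j k \<Longrightarrow> x \<in> carrier (G i) \<Longrightarrow>
      \<rho> j k (\<rho> i j x) = \<rho> i k x"
begin

abbreviation "rel \<equiv> direct_limit_rel I below G \<rho>"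
abbreviation "L \<equiv> direct_limit I below G \<rho>"

definition cls :: "'i \<Rightarrow> 'g \<Rightarrow> ('i \<times> 'g) set" where
  "cls i x = rel `` {(i, x)}"

lemma \<rho>_closed: "i \<in> I \<Longrightarrow> j \<in> I \<Longrightarrow> below i j \<Longrightarrow> x \<in> carrier (G i) \<Longrightarrow> \<rho> i j x \<in> carrier (G j)"
  using hom by (auto simp: hom_def)

lemma \<rho>_mult:
  "i \<in> I \<Longrightarrow> j \<in> I \<Longrightarrow> below i j \<Longrightarrow> x \<in> carrier (G i) \<Longrightarrow> y \<in> carrier (G i) \<Longrightarrow>
     \<rho> i j (x \<otimes>\<^bsub>G i\<^esub> y) = \<rho> i j x \<otimes>\<^bsub>G j\<^esub> \<rho> i j y"
  using hom by (auto simp: hom_def)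

lemma equiv_rel: "equiv (SIGMA i:I. carrier (G i)) rel"
proof (rule equivI)
  show "rel \<subseteq> (SIGMA i:I. carrier (G i)) \<times> (SIGMA i:I. carrier (G i))"
    by (auto simp: direct_limit_rel_def)
  show "refl_on (SIGMA i:I. carrier (G i)) rel"
    by (auto simp: refl_on_def direct_limit_rel_def intro: below_refl)
  show "sym rel" by (fastforce simp: sym_def direct_limit_rel_def)
  show "trans rel"
  proof (rule transI, clarify)
    fix i x j y l z
    assume "((i, x), j, y) \<in> rel" "((j, y), l, z) \<in> rel"
    then obtain k m where *: "i \<in> I" "x \<in> carrier (G i)" "j \<in> I" "y \<in> carrier (G j)" "l \<in> I"
      "z \<in> carrier (G l)" "k \<in> I" "m \<in> I" "below i k" "below j k" "below j m" "below l m"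
      and eq: "\<rho> i k x = \<rho> j k y" "\<rho> j m y = \<rho> l m z"
      unfolding direct_limit_rel_def by auto
    \<comment> \<open>Beyond both bounds \<open>k\<close> and \<open>m\<close> the two equalities
      can be chained through the image of \<open>y\<close>.\<close>
    obtain n where n: "n \<in> I" "below k n" "below m n" using directed * by blast
    have "\<rho> i n x = \<rho> k n (\<rho> i k x)" using comp * n by simp
    also have "\<dots> = \<rho> j n y" unfolding eq using comp * n by simp
    also have "\<dots> = \<rho> m n (\<rho> j m y)" using comp * n by simp
    also have "\<dots> = \<rho> l n z" unfolding eq using comp * n by simp
    finally show "((i, x), l, z) \<in> rel"
      unfolding direct_limit_rel_def using * n below_trans by blast
  qed
qed

lemma cls_eq_iff:
  assumes "i \<in> I" "x \<in> carrier (G i)" "j \<in> I" "y \<in> carrier (G j)"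
  shows "cls i x = cls j y \<longleftrightarrow> (\<exists>k\<in>I. below i k \<and> below j k \<and> \<rho> i k x = \<rho> j k y)"
  using eq_equiv_class_iff[OF equiv_rel, of "(i, x)" "(j, y)"] assms
  by (simp add: cls_def direct_limit_rel_def)

lemma cls_\<rho>:
  assumes "i \<in> I" "x \<in> carrier (G i)" "k \<in> I" "below i k"
  shows "cls k (\<rho> i k x) = cls i x"
proof -
  have "\<rho> k k (\<rho> i k x) = \<rho> i k x" using assms comp below_refl by simp
  then show ?thesis
    using assms below_refl by (subst cls_eq_iff) (auto intro: \<rho>_closed)
qed

lemma carrier_lim: "carrier L = {cls i x |i x. i \<in> I \<and> x \<in> carrier (G i)}"
  by (auto simp: direct_limit_def quotient_def cls_def)

lemma cls_in_carrier: "i \<in> I \<Longrightarrow> x \<in> carrier (G i) \<Longrightarrow> cls i x \<in> carrier L"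
  by (auto simp: carrier_lim)

text \<open>The product in \<open>direct_limit\<close> ranges over all representatives and all upper
  bounds. Each contributes the same class, by \<open>same\<close>, and at least one contributes, by
  \<open>self\<close>.\<close>

lemma mult_cls:
  assumes k: "k \<in> I" and x: "x \<in> carrier (G k)" and y: "y \<in> carrier (G k)"
  shows "cls k x \<otimes>\<^bsub>L\<^esub> cls k y = cls k (x \<otimes>\<^bsub>G k\<^esub> y)"
proof -
  interpret Gk: comm_group "G k" using comm_group k .
  have same: "cls m (\<rho> i m x' \<otimes>\<^bsub>G m\<^esub> \<rho> j m y') = cls k (x \<otimes>\<^bsub>G k\<^esub> y)"
    if mem: "(i, x') \<in> cls k x" "(j, y') \<in> cls k y" and m: "m \<in> I" "below i m" "below j m" for i x' j y' m
  proof -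
    obtain a b where *: "i \<in> I" "x' \<in> carrier (G i)" "j \<in> I" "y' \<in> carrier (G j)" "a \<in> I" "b \<in> I"
      "below i a" "below k a" "below j b" "below k b"
      and eq: "\<rho> k a x = \<rho> i a x'" "\<rho> k b y = \<rho> j b y'"
      using mem unfolding cls_def direct_limit_rel_def by auto
    \<comment> \<open>The goal is an index above \<open>m\<close> and above both witnesses
      \<open>a\<close> and \<open>b\<close>, where all images can be compared.\<close>
    obtain n' where n': "n' \<in> I" "below m n'" "below a n'" using directed * m by blast
    obtain n where n: "n \<in> I" "below n' n" "below b n" using directed * n' by blast
    have mn: "below m n" "below a n" using n n' below_trans by blast+
    then have kn: "below k n" using * below_trans by blast
    have x': "\<rho> m n (\<rho> i m x') = \<rho> k n x"
      using comp[of i m n x'] comp[of i a n x'] comp[of k a n x] * m mn n eq k x by simp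
    have y': "\<rho> m n (\<rho> j m y') = \<rho> k n y"
      using comp[of j m n y'] comp[of j b n y'] comp[of k b n y] * m mn n eq k y by simp
    interpret Gm: comm_group "G m" using comm_group m by blast
    have cl: "\<rho> i m x' \<in> carrier (G m)" "\<rho> j m y' \<in> carrier (G m)"
      using \<rho>_closed * m by auto
    have "\<rho> m n (\<rho> i m x' \<otimes>\<^bsub>G m\<^esub> \<rho> j m y') = \<rho> k n (x \<otimes>\<^bsub>G k\<^esub> y)"
      using \<rho>_mult[of m n, OF _ _ _ cl] \<rho>_mult[of k n x y] x' y' m mn n k kn x y by simp
    then show ?thesis
      using m mn n k kn x y cl by (subst cls_eq_iff) auto
  qed
  have self: "(k, x) \<in> cls k x" "(k, y) \<in> cls k y"
    using equiv_class_self[OF equiv_rel] k x y by (auto simp: cls_def)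
  have "cls k x \<otimes>\<^bsub>L\<^esub> cls k y =
      (\<Union>(i, x')\<in>cls k x. \<Union>(j, y')\<in>cls k y. \<Union>m\<in>{m\<in>I. below i m \<and> below j m}.
         cls m (\<rho> i m x' \<otimes>\<^bsub>G m\<^esub> \<rho> j m y'))"
    by (simp add: direct_limit_def cls_def)
  also have "\<dots> = cls k (x \<otimes>\<^bsub>G k\<^esub> y)"
  proof (rule subset_antisym)
    show "\<dots> \<subseteq> cls k (x \<otimes>\<^bsub>G k\<^esub> y)"
      by (rule UN_least, clarify)+ (use same in blast)
    show "cls k (x \<otimes>\<^bsub>G k\<^esub> y) \<subseteq> (\<Union>(i, x')\<in>cls k x. \<Union>(j, y')\<in>cls k y.
        \<Union>m\<in>{m\<in>I. below i m \<and> below j m}. cls m (\<rho> i m x' \<otimes>\<^bsub>G m\<^esub> \<rho> j m y'))"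
    proof
      fix z assume "z \<in> cls k (x \<otimes>\<^bsub>G k\<^esub> y)"
      then have "z \<in> cls k (\<rho> k k x \<otimes>\<^bsub>G k\<^esub> \<rho> k k y)"
        using same[OF self k] below_refl k by simp
      then show "z \<in> (\<Union>(i, x')\<in>cls k x. \<Union>(j, y')\<in>cls k y.
        \<Union>m\<in>{m\<in>I. below i m \<and> below j m}. cls m (\<rho> i m x' \<otimes>\<^bsub>G m\<^esub> \<rho> j m y'))"
        using self k below_refl by blast
    qed
  qed
  finally show ?thesis .
qed

lemma one_lim:
  assumes i: "i \<in> I"
  shows "\<one>\<^bsub>L\<^esub> = cls i \<one>\<^bsub>G i\<^esub>"
proof -
  have "cls j \<one>\<^bsub>G j\<^esub> = cls i \<one>\<^bsub>G i\<^esub>" if j: "j \<in> I" for j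
  proof -
    obtain k where k: "k \<in> I" "below i k" "below j k" using directed i j by blast
    interpret Gi: comm_group "G i" using comm_group i .
    interpret Gj: comm_group "G j" using comm_group j .
    interpret Gk: comm_group "G k" using comm_group k(1) .
    have "\<rho> i k \<one>\<^bsub>G i\<^esub> = \<one>\<^bsub>G k\<^esub>" "\<rho> j k \<one>\<^bsub>G j\<^esub> = \<one>\<^bsub>G k\<^esub>"
      using hom_one hom i j k Gi.is_group Gj.is_group Gk.is_group by blast+
    then show ?thesis using i j k by (subst cls_eq_iff) auto
  qed
  then have "(\<Union>j\<in>I. cls j \<one>\<^bsub>G j\<^esub>) = cls i \<one>\<^bsub>G i\<^esub>"
    by (intro UN_constant_eq[OF i]) blast
  then show ?thesis by (simp add: direct_limit_def cls_def)
qed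

text \<open>Pushing representatives along the directed set repeatedly places any three elements of
  the limit in one group, where the group axioms can be read off.\<close>

lemma limit_repr:
  assumes "A \<in> carrier L" "j \<in> I"
  obtains k x where "k \<in> I" "below j k" "x \<in> carrier (G k)" "A = cls k x"
proof -
  obtain i y where iy: "i \<in> I" "y \<in> carrier (G i)" "A = cls i y"
    using assms(1) by (auto simp: carrier_lim)
  obtain k where k: "k \<in> I" "below i k" "below j k" using directed iy assms by blast
  show thesis
    using that[of k "\<rho> i k y"] iy k \<rho>_closed cls_\<rho> by simp
qed

lemma comm_group_lim: "comm_group L"
proof -
  have repr3: "\<exists>k x y z. k \<in> I \<and> x \<in> carrier (G k) \<and> y \<in> carrier (G k) \<and> z \<in> carrier (G k) \<and>
      A = cls k x \<and> B = cls k y \<and> C = cls k z"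
    if ABC: "A \<in> carrier L" "B \<in> carrier L" "C \<in> carrier L" for A B C
  proof -
    obtain j0 where "j0 \<in> I" using nonempty by blast
    then obtain i x where i: "i \<in> I" "x \<in> carrier (G i)" "A = cls i x"
      using limit_repr[OF ABC(1)] by metis
    obtain j y where j: "j \<in> I" "below i j" "y \<in> carrier (G j)" "B = cls j y"
      using limit_repr[OF ABC(2) i(1)] .
    obtain k z where k: "k \<in> I" "below j k" "z \<in> carrier (G k)" "C = cls k z"
      using limit_repr[OF ABC(3) j(1)] .
    have "below i k" using j k below_trans by blast
    then show ?thesis
      using i j k \<rho>_closed cls_\<rho>
      by (intro exI[of _ k] exI[of _ "\<rho> i k x"] exI[of _ "\<rho> j k y"] exI[of _ z]) simp
  qed
  show ?thesis
  proof (rule comm_groupI)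
    fix A B assume AB: "A \<in> carrier L" "B \<in> carrier L"
    obtain k x y where k: "k \<in> I" "x \<in> carrier (G k)" "y \<in> carrier (G k)" "A = cls k x" "B = cls k y"
      using repr3[OF AB AB(1)] by blast
    interpret Gk: comm_group "G k" using comm_group k(1) .
    show "A \<otimes>\<^bsub>L\<^esub> B \<in> carrier L" using k by (simp add: mult_cls cls_in_carrier)
    show "A \<otimes>\<^bsub>L\<^esub> B = B \<otimes>\<^bsub>L\<^esub> A" using k by (simp add: mult_cls Gk.m_comm)
  next
    obtain i where i: "i \<in> I" using nonempty by blast
    interpret Gi: comm_group "G i" using comm_group i .
    show "\<one>\<^bsub>L\<^esub> \<in> carrier L" using i by (simp add: one_lim[OF i] cls_in_carrier)
  next
    fix A B C assume ABC: "A \<in> carrier L" "B \<in> carrier L" "C \<in> carrier L"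
    obtain k x y z where k: "k \<in> I" "x \<in> carrier (G k)" "y \<in> carrier (G k)" "z \<in> carrier (G k)"
      "A = cls k x" "B = cls k y" "C = cls k z"
      using repr3[OF ABC] by blast
    interpret Gk: comm_group "G k" using comm_group k(1) .
    show "A \<otimes>\<^bsub>L\<^esub> B \<otimes>\<^bsub>L\<^esub> C = A \<otimes>\<^bsub>L\<^esub> (B \<otimes>\<^bsub>L\<^esub> C)"
      using k by (simp add: mult_cls Gk.m_assoc)
  next
    fix A assume "A \<in> carrier L"
    then obtain k x where k: "k \<in> I" "x \<in> carrier (G k)" "A = cls k x"
      by (auto simp: carrier_lim)
    interpret Gk: comm_group "G k" using comm_group k(1) .
    show "\<one>\<^bsub>L\<^esub> \<otimes>\<^bsub>L\<^esub> A = A" using k by (simp add: one_lim[OF k(1)] mult_cls)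
    show "\<exists>B\<in>carrier L. B \<otimes>\<^bsub>L\<^esub> A = \<one>\<^bsub>L\<^esub>"
      using k by (intro bexI[of _ "cls k (inv\<^bsub>G k\<^esub> x)"])
        (simp_all add: one_lim[OF k(1)] mult_cls cls_in_carrier)
  qed
qed

end

text \<open>An element of infinite order is an independent set of size one. Natural exponents are
  enough, since a negative power is trivial only if the opposite positive power is.\<close>

lemma ab_rank_ge_1:
  fixes G (structure)
  assumes "comm_group G" "a \<in> carrier G"
    and tf: "\<And>m. m > 0 \<Longrightarrow> a [^] (m :: nat) \<noteq> \<one>"
  shows "1 \<le> ab_rank G"
proof -
  interpret comm_group G by (rule assms(1))
  have tf_int: "m = 0" if "a [^] (m :: int) = \<one>" for m
  proof (rule ccontr)
    assume "m \<noteq> 0"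
    have "a [^] nat \<bar>m\<bar> = \<one>"
    proof (cases "m < 0")
      case True
      then have "inv (a [^] nat (- m)) = \<one>" using that by (simp only: int_pow_def2 if_True)
      then have "a [^] nat (- m) = \<one>"
        by (subst (asm) inv_eq_1_iff[OF nat_pow_closed[OF assms(2)]])
      then show ?thesis using True by simp
    next
      case False
      then have "a [^] nat m = \<one>" using that by (simp only: int_pow_def2 if_False)
      then show ?thesis using False by simp
    qed
    with tf[of "nat \<bar>m\<bar>"] \<open>m \<noteq> 0\<close> show False by simp
  qed
  have "int_independent G {a}"
    unfolding int_independent_def
  proof (intro conjI allI impI ballI)
    fix F n x
    assume F: "finite F \<and> F \<subseteq> {a} \<and> finprod G (\<lambda>x. x [^] (n x :: int)) F = \<one>" and x: "x \<in> F"
    then have "F = {a}" by blast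
    with F have "a [^] n a = \<one>" using assms(2) by simp
    then show "n x = 0" using tf_int F x by blast
  qed (use assms(2) in simp)
  then have "enat (card {a}) \<le> ab_rank G"
    unfolding ab_rank_def by (intro SUP_upper) simp
  then show ?thesis by (simp add: one_enat_def)
qed

section \<open>First Cech cohomology\<close>

lemma nerve_pairD: "\<sigma> \<in> nerve (Suc 0) \<U> \<Longrightarrow> \<exists>a b. \<sigma> = [a, b]"
  by (auto simp: nerve_def length_Suc_conv)

lemma nerve_pair_iff: "[a, b] \<in> nerve (Suc 0) \<U> \<longleftrightarrow> a \<in> \<U> \<and> b \<in> \<U> \<and> a \<inter> b \<noteq> {}"
  by (auto simp: nerve_def)

lemma nerve_tripleD: "\<sigma> \<in> nerve (Suc (Suc 0)) \<U> \<Longrightarrow> \<exists>a b d. \<sigma> = [a, b, d]"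
  by (auto simp: nerve_def length_Suc_conv)

lemma nerve_triple_iff:
  "[a, b, d] \<in> nerve (Suc (Suc 0)) \<U> \<longleftrightarrow> a \<in> \<U> \<and> b \<in> \<U> \<and> d \<in> \<U> \<and> a \<inter> b \<inter> d \<noteq> {}"
  by (auto simp: nerve_def)

lemma nerve_map:
  assumes "p \<in> refinement_maps \<U> \<V>" "\<sigma> \<in> nerve n \<V>"
  shows "map p \<sigma> \<in> nerve n \<U>"
proof -
  have "\<Inter>(set \<sigma>) \<subseteq> \<Inter>(set (map p \<sigma>))"
    using assms by (fastforce simp: nerve_def refinement_maps_def)
  then show ?thesis using assms by (auto simp: nerve_def refinement_maps_def)
qed

lemma comm_group_cochains: "comm_group (cochains n \<U>)"
proof (rule comm_groupI)
  fix c assume "c \<in> carrier (cochains n \<U>)"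
  then show "\<exists>d\<in>carrier (cochains n \<U>). d \<otimes>\<^bsub>cochains n \<U>\<^esub> c = \<one>\<^bsub>cochains n \<U>\<^esub>"
    by (intro bexI[of _ "\<lambda>\<sigma>. - c \<sigma>"]) (auto simp: cochains_def)
qed (auto simp: cochains_def)

lemma coboundary_hom: "coboundary n \<U> \<in> hom (cochains n \<U>) (cochains (Suc n) \<U>)"
  by (auto simp: hom_def cochains_def coboundary_def fun_eq_iff sum.distrib algebra_simps)

lemma cocycles_1_iff:
  "c \<in> cocycles (Suc 0) \<U> \<longleftrightarrow> (\<forall>\<sigma>. \<sigma> \<notin> nerve (Suc 0) \<U> \<longrightarrow> c \<sigma> = 0) \<and>
     (\<forall>a\<in>\<U>. \<forall>b\<in>\<U>. \<forall>d\<in>\<U>. a \<inter> b \<inter> d \<noteq> {} \<longrightarrow> c [a, d] = c [a, b] + c [b, d])"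
proof -
  have "coboundary (Suc 0) \<U> c = (\<lambda>_. 0) \<longleftrightarrow>
      (\<forall>a\<in>\<U>. \<forall>b\<in>\<U>. \<forall>d\<in>\<U>. a \<inter> b \<inter> d \<noteq> {} \<longrightarrow> c [a, d] = c [a, b] + c [b, d])"
    (is "?L \<longleftrightarrow> ?R")
  proof -
    have *: "coboundary (Suc 0) \<U> c [a, b, d] = c [b, d] - c [a, d] + c [a, b]"
      if "[a, b, d] \<in> nerve (Suc (Suc 0)) \<U>" for a b d
      using that by (simp add: coboundary_def numeral_2_eq_2 eval_nat_numeral)
    have "?L \<longleftrightarrow> (\<forall>\<sigma>\<in>nerve (Suc (Suc 0)) \<U>. coboundary (Suc 0) \<U> c \<sigma> = 0)"
      by (auto simp: coboundary_def fun_eq_iff)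
    also have "\<dots> \<longleftrightarrow> (\<forall>a b d. [a, b, d] \<in> nerve (Suc (Suc 0)) \<U> \<longrightarrow> c [b, d] - c [a, d] + c [a, b] = 0)"
      using * nerve_tripleD by metis
    also have "\<dots> \<longleftrightarrow> ?R"
    proof -
      have "c [b, d] - c [a, d] + c [a, b] = 0 \<longleftrightarrow> c [a, d] = c [a, b] + c [b, d]" for a b d
        by auto
      then show ?thesis unfolding nerve_triple_iff by blast
    qed
    finally show ?thesis .
  qed
  then show ?thesis by (auto simp: cocycles_def kernel_def cochains_def)
qed

text \<open>The potential may be any function on the cover: among its members \<open>nerve 0\<close>
  leaves out only the empty set, which never occurs in a pair that meets.\<close>

lemma coboundaries_1_iff:
  "h \<in> coboundaries (Suc 0) \<U> \<longleftrightarrow> (\<forall>\<sigma>. \<sigma> \<notin> nerve (Suc 0) \<U> \<longrightarrow> h \<sigma> = 0) \<and>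
     (\<exists>\<beta>. \<forall>a\<in>\<U>. \<forall>b\<in>\<U>. a \<inter> b \<noteq> {} \<longrightarrow> h [a, b] = \<beta> b - \<beta> a)" (is "?L \<longleftrightarrow> ?R")
proof
  have *: "coboundary 0 \<U> c [a, b] = c [b] - c [a]" if "[a, b] \<in> nerve (Suc 0) \<U>" for a b c
    using that by (simp add: coboundary_def)
  show ?R if ?L
  proof -
    obtain c where "h = coboundary 0 \<U> c" using \<open>?L\<close> by (auto simp: coboundaries_def)
    then show ?R
      using * by (auto simp: nerve_pair_iff coboundary_def intro!: exI[of _ "\<lambda>a. c [a]"])
  qed
  show ?L if ?R
  proof -
    obtain \<beta> where \<beta>: "\<forall>a\<in>\<U>. \<forall>b\<in>\<U>. a \<inter> b \<noteq> {} \<longrightarrow> h [a, b] = \<beta> b - \<beta> a"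
      using \<open>?R\<close> by (elim conjE exE)
    define c where "c \<sigma> = (if \<sigma> \<in> nerve 0 \<U> then \<beta> (hd \<sigma>) else 0)" for \<sigma>
    have "h \<sigma> = coboundary 0 \<U> c \<sigma>" for \<sigma>
    proof (cases "\<sigma> \<in> nerve (Suc 0) \<U>")
      case True
      then obtain a b where ab: "\<sigma> = [a, b]" using nerve_pairD by blast
      then have "[a] \<in> nerve 0 \<U>" "[b] \<in> nerve 0 \<U>" using True by (auto simp: nerve_def)
      then show ?thesis
        using True ab * \<beta> by (simp add: c_def nerve_pair_iff)
    next
      case False
      then show ?thesis using \<open>?R\<close> by (simp add: coboundary_def)
    qed
    moreover have "c \<in> carrier (cochains 0 \<U>)" by (simp add: cochains_def c_def)
    ultimately show ?L unfolding coboundaries_def by auto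
  qed
qed

section \<open>The cohomology group of a nerve in degree one\<close>

abbreviation cocycle_group :: "'a set set \<Rightarrow> ('a set list \<Rightarrow> int) monoid" where
  "cocycle_group \<U> \<equiv> (cochains (Suc 0) \<U>)\<lparr>carrier := cocycles (Suc 0) \<U>\<rparr>"

text \<open>The coset is taken among all cochains, as in \<open>refinement_hom\<close>. Cocycles
  have the same addition, so it is also the coset used by the quotient in
  \<open>nerve_cohomology\<close>.\<close>

definition coh :: "'a set set \<Rightarrow> ('a set list \<Rightarrow> int) \<Rightarrow> ('a set list \<Rightarrow> int) set" where
  "coh \<U> c = coboundaries (Suc 0) \<U> #>\<^bsub>cochains (Suc 0) \<U>\<^esub> c"

lemma cochains_mult_one [simp]:
  "c \<otimes>\<^bsub>cochains n \<U>\<^esub> d = (\<lambda>\<sigma>. c \<sigma> + d \<sigma>)" "\<one>\<^bsub>cochains n \<U>\<^esub> = (\<lambda>_. 0)"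
  by (simp_all add: cochains_def)

lemma comm_group_cocycles: "comm_group (cocycle_group \<U>)"
proof -
  interpret comm_group "cochains (Suc 0) \<U>" by (rule comm_group_cochains)
  interpret d: group_hom "cochains (Suc 0) \<U>" "cochains (Suc (Suc 0)) \<U>" "coboundary (Suc 0) \<U>"
    by (intro group_hom.intro group_hom_axioms.intro coboundary_hom is_group
        comm_group.axioms(2) comm_group_cochains)
  have "subgroup (cocycles (Suc 0) \<U>) (cochains (Suc 0) \<U>)"
    unfolding cocycles_def by (rule d.subgroup_kernel)
  then have "Group.group (cocycle_group \<U>)" by (rule subgroup_imp_group)
  then show ?thesis
    by (rule group.group_comm_groupI) (simp add: add.commute)
qed

lemma coboundaries_1_zero: "(\<lambda>_. 0) \<in> coboundaries (Suc 0) \<U>"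
  unfolding coboundaries_1_iff by (auto intro: exI[of _ "\<lambda>_. 0"])

lemma coboundaries_1_diff:
  assumes h: "h \<in> coboundaries (Suc 0) \<U>" and k: "k \<in> coboundaries (Suc 0) \<U>"
  shows "(\<lambda>\<sigma>. h \<sigma> - k \<sigma>) \<in> coboundaries (Suc 0) \<U>"
proof -
  obtain \<beta> where "\<forall>a\<in>\<U>. \<forall>b\<in>\<U>. a \<inter> b \<noteq> {} \<longrightarrow> h [a, b] = \<beta> b - \<beta> a"
    using h unfolding coboundaries_1_iff by blast
  moreover obtain \<gamma> where "\<forall>a\<in>\<U>. \<forall>b\<in>\<U>. a \<inter> b \<noteq> {} \<longrightarrow> k [a, b] = \<gamma> b - \<gamma> a"
    using k unfolding coboundaries_1_iff by blast
  ultimately have "\<forall>a\<in>\<U>. \<forall>b\<in>\<U>. a \<inter> b \<noteq> {} \<longrightarrow>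
      h [a, b] - k [a, b] = (\<beta> b - \<gamma> b) - (\<beta> a - \<gamma> a)"
    by simp
  then show ?thesis
    using h k unfolding coboundaries_1_iff by (intro conjI exI[of _ "\<lambda>a. \<beta> a - \<gamma> a"]) auto
qed

lemma coboundaries_1_add:
  assumes "h \<in> coboundaries (Suc 0) \<U>" "k \<in> coboundaries (Suc 0) \<U>"
  shows "(\<lambda>\<sigma>. h \<sigma> + k \<sigma>) \<in> coboundaries (Suc 0) \<U>"
  using coboundaries_1_diff[OF assms(1) coboundaries_1_diff[OF coboundaries_1_zero assms(2)]]
  by simp

lemma subgroup_coboundaries: "subgroup (coboundaries (Suc 0) \<U>) (cocycle_group \<U>)"
proof -
  interpret comm_group "cocycle_group \<U>" by (rule comm_group_cocycles)
  have sub: "coboundaries (Suc 0) \<U> \<subseteq> cocycles (Suc 0) \<U>"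
  proof
    fix h assume h: "h \<in> coboundaries (Suc 0) \<U>"
    then obtain \<beta> where \<beta>: "\<forall>a\<in>\<U>. \<forall>b\<in>\<U>. a \<inter> b \<noteq> {} \<longrightarrow> h [a, b] = \<beta> b - \<beta> a"
      unfolding coboundaries_1_iff by blast
    have cc: "h [a, d] = h [a, b] + h [b, d]" if "a \<in> \<U>" "b \<in> \<U>" "d \<in> \<U>" "a \<inter> b \<inter> d \<noteq> {}" for a b d
    proof -
      have "a \<inter> b \<noteq> {}" "a \<inter> d \<noteq> {}" "b \<inter> d \<noteq> {}" using that by auto
      then show ?thesis using \<beta> that by simp
    qed
    have "\<forall>\<sigma>. \<sigma> \<notin> nerve (Suc 0) \<U> \<longrightarrow> h \<sigma> = 0"
      using h unfolding coboundaries_1_iff by (rule conjunct1)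
    then show "h \<in> cocycles (Suc 0) \<U>"
      unfolding cocycles_1_iff by (rule conjI) (intro ballI impI cc)
  qed
  show ?thesis
  proof (rule subgroupI)
    show "coboundaries (Suc 0) \<U> \<subseteq> carrier (cocycle_group \<U>)" using sub by simp
    show "coboundaries (Suc 0) \<U> \<noteq> {}" using coboundaries_1_zero by blast
  next
    fix h assume h: "h \<in> coboundaries (Suc 0) \<U>"
    have minus: "(\<lambda>\<sigma>. - h \<sigma>) \<in> coboundaries (Suc 0) \<U>"
      using coboundaries_1_diff[OF coboundaries_1_zero h] by simp
    then have "inv\<^bsub>cocycle_group \<U>\<^esub> h = (\<lambda>\<sigma>. - h \<sigma>)"
      using sub h by (intro inv_equality) auto
    then show "inv\<^bsub>cocycle_group \<U>\<^esub> h \<in> coboundaries (Suc 0) \<U>" using minus by simp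
  qed (simp add: coboundaries_1_add)
qed

lemma mem_coh_iff:
  "e \<in> coh \<U> c \<longleftrightarrow> (\<lambda>\<sigma>. e \<sigma> - c \<sigma>) \<in> coboundaries (Suc 0) \<U>"
proof
  assume "(\<lambda>\<sigma>. e \<sigma> - c \<sigma>) \<in> coboundaries (Suc 0) \<U>"
  then show "e \<in> coh \<U> c"
    unfolding coh_def r_coset_def by (rule UN_I) simp
qed (auto simp: coh_def r_coset_def)

lemma coh_eq_iff:
  "coh \<U> c = coh \<U> d \<longleftrightarrow> (\<lambda>\<sigma>. c \<sigma> - d \<sigma>) \<in> coboundaries (Suc 0) \<U>"
proof
  assume "coh \<U> c = coh \<U> d"
  moreover have "c \<in> coh \<U> c" using coboundaries_1_zero by (simp add: mem_coh_iff)
  ultimately show "(\<lambda>\<sigma>. c \<sigma> - d \<sigma>) \<in> coboundaries (Suc 0) \<U>" by (simp add: mem_coh_iff)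
next
  assume cd: "(\<lambda>\<sigma>. c \<sigma> - d \<sigma>) \<in> coboundaries (Suc 0) \<U>"
  have "(\<lambda>\<sigma>. e \<sigma> - c \<sigma>) \<in> coboundaries (Suc 0) \<U> \<longleftrightarrow> (\<lambda>\<sigma>. e \<sigma> - d \<sigma>) \<in> coboundaries (Suc 0) \<U>" for e
    using coboundaries_1_add[OF _ cd, of "\<lambda>\<sigma>. e \<sigma> - c \<sigma>"]
      coboundaries_1_diff[OF _ cd, of "\<lambda>\<sigma>. e \<sigma> - d \<sigma>"] by auto
  then show "coh \<U> c = coh \<U> d" by (auto simp: mem_coh_iff)
qed

lemma comm_group_nerve_cohomology: "comm_group (nerve_cohomology (Suc 0) \<U>)"
  unfolding nerve_cohomology_def
  using comm_group.abelian_FactGroup[OF comm_group_cocycles subgroup_coboundaries] .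

lemma coh_hom: "coh \<U> \<in> hom (cocycle_group \<U>) (nerve_cohomology (Suc 0) \<U>)"
proof -
  interpret comm_group "cocycle_group \<U>" by (rule comm_group_cocycles)
  have "coboundaries (Suc 0) \<U> \<lhd> cocycle_group \<U>"
    using subgroup_coboundaries normal_iff_subgroup by blast
  then have "(\<lambda>a. coboundaries (Suc 0) \<U> #>\<^bsub>cocycle_group \<U>\<^esub> a) \<in>
      hom (cocycle_group \<U>) (nerve_cohomology (Suc 0) \<U>)"
    unfolding nerve_cohomology_def by (rule normal.r_coset_hom_Mod)
  moreover have "coh \<U> = (\<lambda>a. coboundaries (Suc 0) \<U> #>\<^bsub>cocycle_group \<U>\<^esub> a)"
    by (simp add: coh_def r_coset_def fun_eq_iff)
  ultimately show ?thesis by simp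
qed

lemma carrier_nerve_cohomology:
  "carrier (nerve_cohomology (Suc 0) \<U>) = coh \<U> ` cocycles (Suc 0) \<U>"
  by (auto simp: nerve_cohomology_def FactGroup_def RCOSETS_def coh_def r_coset_def)

lemma mult_coh:
  assumes "c \<in> cocycles (Suc 0) \<U>" "d \<in> cocycles (Suc 0) \<U>"
  shows "coh \<U> c \<otimes>\<^bsub>nerve_cohomology (Suc 0) \<U>\<^esub> coh \<U> d = coh \<U> (\<lambda>\<sigma>. c \<sigma> + d \<sigma>)"
  using coh_hom[of \<U>] assms by (simp add: hom_def)

lemma one_coh: "\<one>\<^bsub>nerve_cohomology (Suc 0) \<U>\<^esub> = coh \<U> (\<lambda>_. 0)"
  using hom_one[OF coh_hom comm_group.axioms(2)[OF comm_group_cocycles]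
      comm_group.axioms(2)[OF comm_group_nerve_cohomology], of \<U>]
  by simp

lemma cocycles_pullback:
  assumes p: "p \<in> refinement_maps \<U> \<V>" and c: "c \<in> cocycles (Suc 0) \<U>"
  shows "cochain_pullback (Suc 0) \<V> p c \<in> cocycles (Suc 0) \<V>"
  unfolding cocycles_1_iff
proof (intro conjI ballI impI allI)
  fix a b d assume *: "a \<in> \<V>" "b \<in> \<V>" "d \<in> \<V>" "a \<inter> b \<inter> d \<noteq> {}"
  then have "[a, b] \<in> nerve (Suc 0) \<V>" "[a, d] \<in> nerve (Suc 0) \<V>" "[b, d] \<in> nerve (Suc 0) \<V>"
    by (auto simp: nerve_pair_iff)
  moreover have "p a \<in> \<U>" "p b \<in> \<U>" "p d \<in> \<U>" "a \<inter> b \<inter> d \<subseteq> p a \<inter> p b \<inter> p d"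
    using p *(1-3) unfolding refinement_maps_def by blast+
  moreover from this(4) have "p a \<inter> p b \<inter> p d \<noteq> {}" using *(4) by blast
  ultimately show "cochain_pullback (Suc 0) \<V> p c [a, d] =
      cochain_pullback (Suc 0) \<V> p c [a, b] + cochain_pullback (Suc 0) \<V> p c [b, d]"
    using c unfolding cocycles_1_iff by (simp add: cochain_pullback_def)
qed (simp add: cochain_pullback_def)

text \<open>The cochain \<open>a \<mapsto> c [p a, q a]\<close> is a homotopy between the pullbacks along \<open>p\<close> and \<open>q\<close>.\<close>

lemma refinement_hom_coh:
  assumes p: "p \<in> refinement_maps \<U> \<V>" and c: "c \<in> cocycles (Suc 0) \<U>"
  shows "refinement_hom (Suc 0) \<U> \<V> (coh \<U> c) = coh \<V> (cochain_pullback (Suc 0) \<V> p c)"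
proof -
  have same: "coh \<V> (cochain_pullback (Suc 0) \<V> q c') = coh \<V> (cochain_pullback (Suc 0) \<V> p c)"
    if c': "c' \<in> coh \<U> c" and q: "q \<in> refinement_maps \<U> \<V>" for c' q
  proof -
    obtain h where h: "h \<in> coboundaries (Suc 0) \<U>" "c' = (\<lambda>\<sigma>. h \<sigma> + c \<sigma>)"
      using c' by (auto simp: coh_def r_coset_def)
    then obtain \<beta> where \<beta>: "\<forall>a\<in>\<U>. \<forall>b\<in>\<U>. a \<inter> b \<noteq> {} \<longrightarrow> h [a, b] = \<beta> b - \<beta> a"
      unfolding coboundaries_1_iff by blast
    have cc: "c [a, d] = c [a, b] + c [b, d]" if "a \<in> \<U>" "b \<in> \<U>" "d \<in> \<U>" "a \<inter> b \<inter> d \<noteq> {}" for a b d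
      using c that unfolding cocycles_1_iff by blast
    \<comment> \<open>The summand \<open>\<beta> (q a)\<close> absorbs the change of representative
      from \<open>c\<close> to \<open>c'\<close>.\<close>
    define \<gamma> where "\<gamma> a = \<beta> (q a) + c [p a, q a]" for a
    have "cochain_pullback (Suc 0) \<V> q c' [a, b] - cochain_pullback (Suc 0) \<V> p c [a, b] = \<gamma> b - \<gamma> a"
      if ab: "a \<in> \<V>" "b \<in> \<V>" "a \<inter> b \<noteq> {}" for a b
    proof -
      have sub: "p a \<in> \<U>" "p b \<in> \<U>" "q a \<in> \<U>" "q b \<in> \<U>" "a \<subseteq> p a" "a \<subseteq> q a" "b \<subseteq> p b" "b \<subseteq> q b"
        using p q ab by (auto simp: refinement_maps_def)
      \<comment> \<open>There are two paths from \<open>p a\<close> to \<open>q b\<close>, through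
        \<open>p b\<close> and through \<open>q a\<close>; both triple intersections contain
        \<open>a \<inter> b\<close>.\<close>
      have "c [p a, q b] = c [p a, p b] + c [p b, q b]"
        by (rule cc) (use sub ab in auto)
      moreover have "c [p a, q b] = c [p a, q a] + c [q a, q b]"
        by (rule cc) (use sub ab in auto)
      moreover have "h [q a, q b] = \<beta> (q b) - \<beta> (q a)"
        by (rule \<beta>[rule_format, OF sub(3,4)]) (use sub ab in auto)
      ultimately show ?thesis
        using ab by (simp add: cochain_pullback_def nerve_pair_iff h \<gamma>_def)
    qed
    then show ?thesis
      unfolding coh_eq_iff coboundaries_1_iff by (auto simp: cochain_pullback_def)
  qed
  have "refinement_hom (Suc 0) \<U> \<V> (coh \<U> c) =
      (\<Union>c'\<in>coh \<U> c. \<Union>q\<in>refinement_maps \<U> \<V>. coh \<V> (cochain_pullback (Suc 0) \<V> q c'))"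
    by (simp add: refinement_hom_def coh_def)
  also have "\<dots> = (\<Union>c'\<in>coh \<U> c. \<Union>q\<in>refinement_maps \<U> \<V>. coh \<V> (cochain_pullback (Suc 0) \<V> p c))"
    using same by simp
  also have "\<dots> = coh \<V> (cochain_pullback (Suc 0) \<V> p c)"
  proof -
    have "c \<in> coh \<U> c" using coboundaries_1_zero by (simp add: mem_coh_iff)
    then show ?thesis using p by auto
  qed
  finally show ?thesis .
qed

section \<open>Refinements of covers and the limit group\<close>

lemma refinement_map_exists:
  assumes "refined_by \<U> \<V>"
  obtains p where "p \<in> refinement_maps \<U> \<V>"
proof -
  have "\<exists>p. \<forall>V\<in>\<V>. p V \<in> \<U> \<and> V \<subseteq> p V"
    by (rule bchoice) (use assms in \<open>auto simp: refined_by_def\<close>)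
  then show thesis using that by (auto simp: refinement_maps_def)
qed

text \<open>The laws for the transition maps reduce to cochains, because
  \<open>refinement_hom\<close> can be computed with any one refinement map, in particular with a
  composite.\<close>

lemma cech_system:
  "directed_group_system (open_covers X) refined_by (nerve_cohomology (Suc 0)) (refinement_hom (Suc 0))"
proof (rule directed_group_system.intro)
  show "open_covers X \<noteq> {}"
    by (auto simp: open_covers_def intro!: exI[of _ "{topspace X}"])
  show "refined_by \<U> \<U>" for \<U> :: "'a set set"
    by (auto simp: refined_by_def)
  show "refined_by \<U> \<W>" if "refined_by \<U> \<V>" "refined_by \<V> \<W>" for \<U> \<V> \<W> :: "'a set set"
    using that unfolding refined_by_def by (meson subset_trans)
  show "\<exists>\<W>\<in>open_covers X. refined_by \<U> \<W> \<and> refined_by \<V> \<W>"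
    if "\<U> \<in> open_covers X" "\<V> \<in> open_covers X" for \<U> \<V>
  proof (rule bexI)
    let ?W = "(\<lambda>(U, V). U \<inter> V) ` (\<U> \<times> \<V>)"
    have "\<Union>?W = \<Union>\<U> \<inter> \<Union>\<V>" by auto
    then show "?W \<in> open_covers X" using that by (auto simp: open_covers_def)
    show "refined_by \<U> ?W \<and> refined_by \<V> ?W" by (auto simp: refined_by_def)
  qed
  show "comm_group (nerve_cohomology (Suc 0) \<U>)" for \<U> :: "'a set set"
    by (rule comm_group_nerve_cohomology)
  show "refinement_hom (Suc 0) \<U> \<V> \<in> hom (nerve_cohomology (Suc 0) \<U>) (nerve_cohomology (Suc 0) \<V>)"
    if r: "refined_by \<U> \<V>" for \<U> \<V> :: "'a set set"
  proof -
    obtain p where p: "p \<in> refinement_maps \<U> \<V>" using refinement_map_exists r .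
    have "(\<lambda>\<sigma>. c \<sigma> + d \<sigma>) \<in> cocycles (Suc 0) \<U>"
      if "c \<in> cocycles (Suc 0) \<U>" "d \<in> cocycles (Suc 0) \<U>" for c d
      using that unfolding cocycles_1_iff by auto
    moreover have "cochain_pullback (Suc 0) \<V> p (\<lambda>\<sigma>. c \<sigma> + d \<sigma>) =
        (\<lambda>\<sigma>. cochain_pullback (Suc 0) \<V> p c \<sigma> + cochain_pullback (Suc 0) \<V> p d \<sigma>)" for c d
      by (auto simp: cochain_pullback_def)
    ultimately show ?thesis
      by (auto simp: hom_def carrier_nerve_cohomology mult_coh refinement_hom_coh[OF p] cocycles_pullback[OF p])
  qed
  show "refinement_hom (Suc 0) \<V> \<W> (refinement_hom (Suc 0) \<U> \<V> A) = refinement_hom (Suc 0) \<U> \<W> A"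
    if r: "refined_by \<U> \<V>" "refined_by \<V> \<W>" and A: "A \<in> carrier (nerve_cohomology (Suc 0) \<U>)"
    for \<U> \<V> \<W> :: "'a set set" and A
  proof -
    obtain p where p: "p \<in> refinement_maps \<U> \<V>" using refinement_map_exists r(1) .
    obtain q where q: "q \<in> refinement_maps \<V> \<W>" using refinement_map_exists r(2) .
    have pq: "p \<circ> q \<in> refinement_maps \<U> \<W>"
      using p q unfolding refinement_maps_def by fastforce
    obtain c where c: "c \<in> cocycles (Suc 0) \<U>" "A = coh \<U> c"
      using A by (auto simp: carrier_nerve_cohomology)
    have "cochain_pullback (Suc 0) \<W> q (cochain_pullback (Suc 0) \<V> p c) =
        cochain_pullback (Suc 0) \<W> (p \<circ> q) c"
      using nerve_map[OF q, of _ "Suc 0"] by (auto simp: cochain_pullback_def)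
    then show ?thesis
      using c by (simp add: refinement_hom_coh[OF p] refinement_hom_coh[OF q] refinement_hom_coh[OF pq]
          cocycles_pullback[OF p])
  qed
qed

text \<open>Equality in the direct limit is already visible on some refinement, so a trivial
  multiple of the class of \<open>c\<close> yields a cover and a potential of the kind that
  \<open>no\<close> forbids.\<close>

lemma cech_rank_ge_1:
  assumes \<U>: "\<U> \<in> open_covers X" and c: "c \<in> cocycles (Suc 0) \<U>"
    and no: "\<And>\<W> p m \<beta>. \<lbrakk>\<W> \<in> open_covers X; p \<in> refinement_maps \<U> \<W>; m > 0;
      \<And>a b. a \<in> \<W> \<Longrightarrow> b \<in> \<W> \<Longrightarrow> a \<inter> b \<noteq> {} \<Longrightarrow> int m * c [p a, p b] = \<beta> b - \<beta> a\<rbrakk> \<Longrightarrow> False"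
  shows "1 \<le> ab_rank (cech_cohomology (Suc 0) X)"
proof -
  interpret directed_group_system "open_covers X" refined_by "nerve_cohomology (Suc 0)" "refinement_hom (Suc 0)"
    by (rule cech_system)
  have mc: "(\<lambda>\<sigma>. m * c \<sigma>) \<in> cocycles (Suc 0) \<U>" for m
    using c unfolding cocycles_1_iff by (simp add: distrib_left)
  have coh_carrier: "coh \<U> (\<lambda>\<sigma>. m * c \<sigma>) \<in> carrier (nerve_cohomology (Suc 0) \<U>)" for m
    using mc by (simp add: carrier_nerve_cohomology)
  define A where "A = cls \<U> (coh \<U> c)"
  have A: "A \<in> carrier L"
    unfolding A_def using coh_carrier[of 1] \<U> by (simp add: cls_in_carrier)
  interpret L: comm_group L by (rule comm_group_lim)
  have one: "\<one>\<^bsub>L\<^esub> = cls \<U> (coh \<U> (\<lambda>\<sigma>. 0 * c \<sigma>))"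
    using one_lim[OF \<U>] by (simp add: one_coh)
  have pow: "A [^]\<^bsub>L\<^esub> m = cls \<U> (coh \<U> (\<lambda>\<sigma>. int m * c \<sigma>))" for m :: nat
  proof (induction m)
    case 0
    then show ?case using one by simp
  next
    case (Suc m)
    have "A [^]\<^bsub>L\<^esub> Suc m = A [^]\<^bsub>L\<^esub> m \<otimes>\<^bsub>L\<^esub> A" by simp
    also have "\<dots> = cls \<U> (coh \<U> (\<lambda>\<sigma>. int m * c \<sigma>)) \<otimes>\<^bsub>L\<^esub> cls \<U> (coh \<U> c)"
      unfolding Suc.IH unfolding A_def ..
    also have "\<dots> = cls \<U> (coh \<U> (\<lambda>\<sigma>. int m * c \<sigma>) \<otimes>\<^bsub>nerve_cohomology (Suc 0) \<U>\<^esub> coh \<U> c)"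
      using coh_carrier[of m] coh_carrier[of 1] \<U> by (intro mult_cls) simp_all
    also have "\<dots> = cls \<U> (coh \<U> (\<lambda>\<sigma>. int (Suc m) * c \<sigma>))"
      using mult_coh[OF mc c] by (simp add: algebra_simps)
    finally show ?case .
  qed
  have "A [^]\<^bsub>L\<^esub> m \<noteq> \<one>\<^bsub>L\<^esub>" if m: "m > 0" for m :: nat
  proof
    assume "A [^]\<^bsub>L\<^esub> m = \<one>\<^bsub>L\<^esub>"
    then have "cls \<U> (coh \<U> (\<lambda>\<sigma>. int m * c \<sigma>)) = cls \<U> (coh \<U> (\<lambda>\<sigma>. 0 * c \<sigma>))"
      unfolding pow one .
    then obtain \<W> where \<W>: "\<W> \<in> open_covers X" "refined_by \<U> \<W>" and eq:
      "refinement_hom (Suc 0) \<U> \<W> (coh \<U> (\<lambda>\<sigma>. int m * c \<sigma>)) =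
       refinement_hom (Suc 0) \<U> \<W> (coh \<U> (\<lambda>\<sigma>. 0 * c \<sigma>))"
      unfolding cls_eq_iff[OF \<U> coh_carrier \<U> coh_carrier] by blast
    obtain p where p: "p \<in> refinement_maps \<U> \<W>" using refinement_map_exists \<W>(2) .
    have "(\<lambda>\<sigma>. cochain_pullback (Suc 0) \<W> p (\<lambda>\<sigma>. int m * c \<sigma>) \<sigma> -
        cochain_pullback (Suc 0) \<W> p (\<lambda>\<sigma>. 0 * c \<sigma>) \<sigma>) \<in> coboundaries (Suc 0) \<W>"
      using eq unfolding refinement_hom_coh[OF p mc] coh_eq_iff .
    then obtain \<beta> where \<beta>: "\<forall>a\<in>\<W>. \<forall>b\<in>\<W>. a \<inter> b \<noteq> {} \<longrightarrow>
        cochain_pullback (Suc 0) \<W> p (\<lambda>\<sigma>. int m * c \<sigma>) [a, b] -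
        cochain_pullback (Suc 0) \<W> p (\<lambda>\<sigma>. 0 * c \<sigma>) [a, b] = \<beta> b - \<beta> a"
      unfolding coboundaries_1_iff by (elim conjE exE)
    have "int m * c [p a, p b] = \<beta> b - \<beta> a" if ab: "a \<in> \<W>" "b \<in> \<W>" "a \<inter> b \<noteq> {}" for a b
      using \<beta>[rule_format, OF ab] ab by (simp add: cochain_pullback_def nerve_pair_iff)
    then show False by (rule no[OF \<W>(1) p m])
  qed
  then show ?thesis
    unfolding cech_cohomology_def by (rule ab_rank_ge_1[OF comm_group_lim A])
qed

section \<open>Logarithms of maps to the circle\<close>

text \<open>This is continuous on the whole circle, but an inverse of \<open>cis\<close> only on the
  open half circle around \<open>cis t\<close>, which is rotated to be centred at 1 before the
  arcsine is taken.\<close>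

definition circle_log :: "real \<Rightarrow> complex \<Rightarrow> real" where
  "circle_log t w = t + arcsin (Im (w * cis (- t)))"

lemma continuous_on_circle_log: "continuous_on (sphere 0 1) (circle_log t)"
proof -
  have bound: "- 1 \<le> Im (w * cis (- t)) \<and> Im (w * cis (- t)) \<le> 1" if "w \<in> sphere 0 1" for w
  proof -
    have "\<bar>Im (w * cis (- t))\<bar> \<le> cmod w * cmod (cis (- t))"
      unfolding norm_mult[symmetric] by (rule abs_Im_le_cmod)
    then have "\<bar>Im (w * cis (- t))\<bar> \<le> 1" using that by simp
    then show ?thesis unfolding abs_le_iff by linarith
  qed
  then show ?thesis
    unfolding circle_log_def by (intro continuous_intros ballI) blast+
qed

lemma circle_log:
  assumes w: "cmod w = 1" and pos: "Re (w * cis (- t)) > 0"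
  shows "cis (circle_log t w) = w" "\<bar>circle_log t w - t\<bar> < pi / 2"
proof -
  define z where "z = w * cis (- t)"
  have "(cmod z)\<^sup>2 = 1" using w by (simp add: z_def norm_mult)
  then have z: "(Re z)\<^sup>2 + (Im z)\<^sup>2 = 1" by (simp add: cmod_power2)
  have "Re z > 0" using pos by (simp add: z_def)
  then have "(Im z)\<^sup>2 < 1" using z by (smt (verit) zero_less_power)
  then have "\<bar>Im z\<bar> < 1" by (simp only: abs_square_less_1)
  then have im: "- 1 < Im z" "Im z < 1" by linarith+
  have "sqrt (1 - (Im z)\<^sup>2) = Re z"
    using z \<open>Re z > 0\<close> by (intro real_sqrt_unique) auto
  then have "cis (arcsin (Im z)) = z"
    using im by (simp add: complex_eq_iff cos_arcsin)
  moreover have "cis (circle_log t w) = cis t * cis (arcsin (Im z))"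
    by (simp add: circle_log_def z_def cis_mult)
  moreover have "cis t * z = w" by (simp add: z_def mult.left_commute cis_mult)
  ultimately show "cis (circle_log t w) = w" by simp
  have "- (pi / 2) < arcsin (Im z)" "arcsin (Im z) < pi / 2"
    using arcsin_lt_bounded[OF im] by auto
  then show "\<bar>circle_log t w - t\<bar> < pi / 2"
    unfolding circle_log_def z_def[symmetric] by (simp add: abs_less_iff)
qed

text \<open>
  The differences of the logarithms of \<open>v\<close> over half circles form a cocycle. If \<open>m\<close> times this cocycle is
  the coboundary of \<open>\<beta>\<close> on a refinement, then correcting the logarithms by \<open>\<beta> div m\<close> makes them
  agree on overlaps.
\<close>

lemma circle_log_of_cech_rank_0:
  assumes v: "continuous_map X euclidean v" "\<And>x. x \<in> topspace X \<Longrightarrow> cmod (v x) = 1"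
    and rank: "\<not> 1 \<le> ab_rank (cech_cohomology 1 X)"
  obtains \<phi> where "continuous_map X euclideanreal \<phi>" "\<And>x. x \<in> topspace X \<Longrightarrow> v x = cis (\<phi> x)"
proof -
  define arc where "arc t = {y \<in> topspace X. Re (v y * cis (- t)) > 0}" for t
  define \<U> where "\<U> = range arc"
  have "openin X (arc t)" for t
  proof -
    have "open {w. Re (w * cis (- t)) > 0}"
      by (intro open_Collect_less continuous_intros)
    then have "openin X {y \<in> topspace X. v y \<in> {w. Re (w * cis (- t)) > 0}}"
      by (intro openin_continuous_map_preimage[OF v(1)]) (simp only: open_openin[symmetric])
    then show ?thesis by (simp only: arc_def mem_Collect_eq)
  qed
  moreover have "y \<in> \<Union>\<U>" if y: "y \<in> topspace X" for y
  proof -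
    obtain t where "v y = cis t"
      using v(2)[OF y] by (metis cis_Arg norm_zero zero_neq_one sgn_div_norm div_by_1 scaleR_one inverse_1)
    then have "y \<in> arc t" using y by (simp add: arc_def cis_mult)
    then show ?thesis by (auto simp: \<U>_def)
  qed
  moreover have "arc t \<subseteq> topspace X" for t by (auto simp: arc_def)
  ultimately have \<U>: "\<U> \<in> open_covers X" by (auto simp: open_covers_def \<U>_def)
  \<comment> \<open>A cover is a set of sets and different angles can give the same member, so one
    centre is chosen for each.\<close>
  define \<tau> where "\<tau> V = (SOME t. V = arc t)" for V
  have \<tau>: "V = arc (\<tau> V)" if V: "V \<in> \<U>" for V
  proof -
    have "\<exists>t. V = arc t" using V by (auto simp: \<U>_def)
    then show ?thesis unfolding \<tau>_def by (rule someI_ex)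
  qed
  define l where "l V y = circle_log (\<tau> V) (v y)" for V y
  have l: "cis (l V y) = v y \<and> \<bar>l V y - \<tau> V\<bar> < pi / 2 \<and> y \<in> topspace X" if V: "V \<in> \<U>" "y \<in> V" for V y
  proof -
    have "y \<in> arc (\<tau> V)" using \<tau>[OF V(1)] V(2) by simp
    then show ?thesis unfolding l_def using circle_log[of "v y" "\<tau> V"] v(2) by (simp add: arc_def)
  qed
  have l_cont: "continuous_map X euclideanreal (l V)" for V
  proof -
    have "continuous_map X (top_of_set (sphere 0 1)) v"
      using v by (auto simp: continuous_map_in_subtopology)
    moreover have "continuous_map (top_of_set (sphere 0 1)) euclideanreal (circle_log (\<tau> V))"
      using continuous_on_circle_log by simp
    ultimately have "continuous_map X euclideanreal (circle_log (\<tau> V) \<circ> v)"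
      by (rule continuous_map_compose)
    then show ?thesis by (simp add: o_def l_def[abs_def])
  qed
  have "\<exists>k::int. \<forall>y\<in>a \<inter> b. l b y - l a y = 2 * pi * k" if ab: "a \<in> \<U>" "b \<in> \<U>" for a b
  proof -
    have ex: "\<exists>k::int. l b y - l a y = 2 * pi * k" if "y \<in> a \<inter> b" for y
    proof -
      have "cis (l b y) = cis (l a y)" using l ab that by simp
      then have "cis (l b y - l a y) = 1" by (simp flip: cis_divide)
      then have "cos (l b y - l a y) = 1" by (metis cis.sel(1) one_complex.sel(1))
      then show ?thesis unfolding cos_one_2pi_int by (metis mult.commute mult.assoc)
    qed
    show ?thesis
    proof (cases "a \<inter> b = {}")
      case False
      then obtain x where x: "x \<in> a \<inter> b" by blast
      obtain k :: int where k: "l b x - l a x = 2 * pi * k" using ex[OF x] by blast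
      have "l b y - l a y = 2 * pi * k" if y: "y \<in> a \<inter> b" for y
      proof -
        obtain j :: int where j: "l b y - l a y = 2 * pi * j" using ex[OF y] by blast
        \<comment> \<open>The overlap may be disconnected, so continuity alone does not make the
          integer constant. Instead all four logarithms stay within \<open>pi / 2\<close> of their
          centres, so the two differences are less than \<open>2 * pi\<close> apart.\<close>
        have "\<bar>l b x - \<tau> b\<bar> < pi / 2" "\<bar>l a x - \<tau> a\<bar> < pi / 2" "\<bar>l b y - \<tau> b\<bar> < pi / 2" "\<bar>l a y - \<tau> a\<bar> < pi / 2"
          using l ab x y by auto
        then have "\<bar>(l b y - l a y) - (l b x - l a x)\<bar> < 2 * pi" by linarith
        then have "\<bar>2 * pi * (real_of_int j - real_of_int k)\<bar> < 2 * pi * 1"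
          unfolding j k by (simp add: right_diff_distrib)
        then have "\<bar>real_of_int (j - k)\<bar> < 1"
          unfolding abs_mult by simp
        then have "j = k" by linarith
        then show ?thesis using j by simp
      qed
      then show ?thesis by blast
    qed simp
  qed
  then obtain k :: "'a set \<Rightarrow> 'a set \<Rightarrow> int" where
    k: "\<And>a b y. a \<in> \<U> \<Longrightarrow> b \<in> \<U> \<Longrightarrow> y \<in> a \<inter> b \<Longrightarrow> l b y - l a y = 2 * pi * k a b"
    by metis
  define c where "c \<sigma> = (if \<sigma> \<in> nerve (Suc 0) \<U> then k (hd \<sigma>) (last \<sigma>) else 0)" for \<sigma>
  have c_pair: "c [a, b] = k a b" if "a \<in> \<U>" "b \<in> \<U>" "y \<in> a \<inter> b" for a b y
  proof -
    have "[a, b] \<in> nerve (Suc 0) \<U>" unfolding nerve_pair_iff using that by blast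
    then show ?thesis by (simp add: c_def)
  qed
  have c: "c \<in> cocycles (Suc 0) \<U>"
    unfolding cocycles_1_iff
  proof (intro conjI ballI impI allI)
    fix a b d assume abd: "a \<in> \<U>" "b \<in> \<U>" "d \<in> \<U>" "a \<inter> b \<inter> d \<noteq> {}"
    then obtain y where y: "y \<in> a \<inter> b" "y \<in> a \<inter> d" "y \<in> b \<inter> d" by blast
    have "2 * pi * real_of_int (k a d) = 2 * pi * real_of_int (k a b) + 2 * pi * real_of_int (k b d)"
      using k[OF abd(1,3) y(2)] k[OF abd(1,2) y(1)] k[OF abd(2,3) y(3)] by linarith
    then have "2 * pi * real_of_int (k a d) = 2 * pi * real_of_int (k a b + k b d)"
      by (simp add: distrib_left)
    then have "k a d = k a b + k b d"
      by (simp only: mult_cancel_left of_int_eq_iff) simp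
    then show "c [a, d] = c [a, b] + c [b, d]"
      using c_pair abd y by metis
  qed (simp add: c_def)
  have "\<exists>\<phi>. continuous_map X euclideanreal \<phi> \<and> (\<forall>x\<in>topspace X. v x = cis (\<phi> x))"
  proof (rule ccontr)
    \<comment> \<open>Without a logarithm no positive multiple of \<open>c\<close> bounds on a
      refinement, since a potential would produce a logarithm; so the rank would be at least
      one.\<close>
    assume none: "\<not> ?thesis"
    have "1 \<le> ab_rank (cech_cohomology (Suc 0) X)"
    proof (rule cech_rank_ge_1[OF \<U> c])
      fix \<W> p m \<beta>
      assume \<W>: "\<W> \<in> open_covers X" and p: "p \<in> refinement_maps \<U> \<W>" and m: "m > (0::nat)"
        and \<beta>: "\<And>a b. a \<in> \<W> \<Longrightarrow> b \<in> \<W> \<Longrightarrow> a \<inter> b \<noteq> {} \<Longrightarrow> int m * c [p a, p b] = \<beta> b - \<beta> a"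
      define h where "h a y = l (p a) y - 2 * pi * of_int (\<beta> a div int m)" for a y
      have pU: "p a \<in> \<U>" "a \<subseteq> p a" if "a \<in> \<W>" for a
        using p that by (auto simp: refinement_maps_def)
      have cover: "\<Union>\<W> = topspace X" using \<W> by (simp add: open_covers_def)
      have agree: "h a y = h b y" if a: "a \<in> \<W>" "y \<in> a" and b: "b \<in> \<W>" "y \<in> b" for a b y
      proof -
        have y: "y \<in> p a \<inter> p b" using a b pU by blast
        have "\<beta> b = \<beta> a + int m * k (p a) (p b)"
        proof -
          have "a \<inter> b \<noteq> {}" using a b by blast
          then show ?thesis
            using \<beta>[OF a(1) b(1)] c_pair[OF pU(1)[OF a(1)] pU(1)[OF b(1)] y] by simp
        qed
        \<comment> \<open>On overlaps \<open>\<beta>\<close> changes by a multiple of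
          \<open>m\<close>, so the remainder is the same on both sides and the rounded quotient
          changes by exactly \<open>k (p a) (p b)\<close>.\<close>
        then have "\<beta> b div int m = \<beta> a div int m + k (p a) (p b)" using m by simp
        then show ?thesis
          using k[OF pU(1)[OF a(1)] pU(1)[OF b(1)] y] by (simp add: h_def distrib_left)
      qed
      define \<phi> where "\<phi> y = h (SOME a. a \<in> \<W> \<and> y \<in> a) y" for y
      have \<phi>: "\<phi> y = h a y" if "a \<in> \<W>" "y \<in> a" for a y
      proof -
        have "(SOME a. a \<in> \<W> \<and> y \<in> a) \<in> \<W> \<and> y \<in> (SOME a. a \<in> \<W> \<and> y \<in> a)"
          by (rule someI[of _ a]) (use that in blast)
        then show ?thesis unfolding \<phi>_def using agree that by blast
      qed
      have "continuous_map X euclideanreal \<phi>"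
      proof (rule pasting_lemma[where I = \<W> and T = "\<lambda>a. a" and f = h])
        show "openin X a" if "a \<in> \<W>" for a using \<W> that by (simp add: open_covers_def)
        show "continuous_map (subtopology X a) euclideanreal (h a)" for a
          unfolding h_def using continuous_map_from_subtopology[OF l_cont]
          by (intro continuous_map_diff) auto
        show "h a y = h b y" if "a \<in> \<W>" "b \<in> \<W>" "y \<in> topspace X \<inter> a \<inter> b" for a b y
          using agree that by blast
        show "\<exists>a. a \<in> \<W> \<and> y \<in> a \<and> \<phi> y = h a y" if "y \<in> topspace X" for y
          using \<phi> that cover by blast
      qed
      moreover have "v y = cis (\<phi> y)" if "y \<in> topspace X" for y
      proof -
        obtain a where a: "a \<in> \<W>" "y \<in> a" using \<open>y \<in> topspace X\<close> cover by blast
        then have "cis (l (p a) y) = v y" using l pU by blast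
        moreover have "cis (h a y) = cis (l (p a) y) * cis (- (2 * pi * of_int (\<beta> a div int m)))"
          by (simp add: h_def cis_mult)
        moreover have "cis (- (2 * pi * of_int (\<beta> a div int m))) = 1"
          using cis_multiple_2pi[of "of_int (- (\<beta> a div int m))"] by simp
        ultimately show ?thesis using \<phi>[OF a] by simp
      qed
      ultimately show False using none by blast
    qed
    with rank show False by simp
  qed
  then show thesis using that by blast
qed

section \<open>Maps from the sphere and from projective space\<close>

lemma null_homotopic_S3:
  assumes f: "continuous_map S3 S2 f"
    and rank: "\<not> 1 \<le> ab_rank (cech_cohomology 1 (subtopology S3 {x \<in> topspace S3. f x = hopf (1, 0)}))"
  shows "null_homotopic S3 S2 f"
proof -
  let ?S = "sphere 0 1 :: (complex \<times> complex) set"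
  have f1: "norm (f x) = 1" if "x \<in> ?S" for x
    using f that by auto
  obtain g where g: "continuous_on ?S g" "\<And>x. x \<in> ?S \<Longrightarrow> norm (g x) = 1"
    "\<And>x. x \<in> ?S \<Longrightarrow> hopf (g x) = f x"
    using hopf_lifts_S3[of f] f f1 unfolding hopf_lifts_def by auto
  define K where "K = {x \<in> ?S. f x = hopf (1, 0)}"
  have "closed K"
    unfolding K_def using f by (intro continuous_closed_preimage_constant) auto
  have snd0: "snd (g x) = 0 \<longleftrightarrow> x \<in> K" if "x \<in> ?S" for x
    using that g hopf_eq_base_iff[of "g x"] by (simp add: K_def hopf_base)
  have "continuous_map (top_of_set K) euclidean (\<lambda>x. fst (g x))"
    by (auto intro!: continuous_intros continuous_on_subset[OF g(1)] simp: K_def)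
  moreover have "cmod (fst (g x)) = 1" if "x \<in> K" for x
    using that snd0[of x] g(2)[of x] by (auto simp: K_def norm_prod_def)
  moreover have "subtopology S3 {x \<in> topspace S3. f x = hopf (1, 0)} = top_of_set K"
    by (simp add: K_def subtopology_subtopology Int_def)
  ultimately obtain \<phi> where \<phi>: "continuous_on K \<phi>" "\<And>x. x \<in> K \<Longrightarrow> fst (g x) = cis (\<phi> x)"
    using circle_log_of_cech_rank_0[of "top_of_set K" "\<lambda>x. fst (g x)"] rank by auto
  \<comment> \<open>\<open>null_homotopic_hopf\<close> wants an angle on the whole sphere but
    constrains it only over the base point, so any extension of \<open>\<phi>\<close>
    serves.\<close>
  obtain \<Phi> where \<Phi>: "continuous_on UNIV \<Phi>" "\<And>x. x \<in> K \<Longrightarrow> \<Phi> x = \<phi> x"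
    using Tietze_real[OF \<open>closed K\<close> \<phi>(1)] by blast
  show ?thesis
  proof (rule null_homotopic_hopf[where g = g and \<phi> = \<Phi>])
    show "continuous_map S3 euclideanreal \<Phi>"
      using \<Phi>(1) by (auto intro: continuous_on_subset)
  qed (use g \<Phi>(2) \<phi>(2) snd0 in auto)
qed

lemma null_homotopic_RP3:
  assumes f: "continuous_map RP3 S2 f"
    and rank: "\<not> 1 \<le> ab_rank (cech_cohomology 1 (subtopology RP3 {x \<in> topspace RP3. f x = hopf (1, 0)}))"
  shows "null_homotopic RP3 S2 f"
proof -
  let ?S = "sphere 0 1 :: (complex \<times> complex) set"
  define F where "F x = f {x, - x}" for x
  have F: "continuous_on ?S F" and "F \<in> ?S \<rightarrow> sphere 0 1"
    using f unfolding continuous_map_RP3_iff F_def by simp_all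
  then have F1: "norm (F x) = 1" if "x \<in> ?S" for x
    using that by (metis Pi_mem mem_sphere_0)
  have Feven: "F (- x) = F x" for x by (simp add: F_def insert_commute)
  obtain g where g: "continuous_on ?S g" "\<And>x. x \<in> ?S \<Longrightarrow> norm (g x) = 1"
    "\<And>x. x \<in> ?S \<Longrightarrow> hopf (g x) = F x"
    and parity: "(\<forall>x\<in>?S. g (- x) = g x) \<or> (\<forall>x\<in>?S. g (- x) = - g x)"
    using hopf_lift_of_even[OF F F1 Feven] by blast
  define K where "K = {x \<in> ?S. F x = hopf (1, 0)}"
  define L where "L = {A \<in> topspace RP3. f A = hopf (1, 0)}"
  have "closed K"
    unfolding K_def by (intro continuous_closed_preimage_constant F) auto
  have snd0: "snd (g x) = 0 \<longleftrightarrow> x \<in> K" if "x \<in> ?S" for x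
    using that g hopf_eq_base_iff[of "g x"] by (simp add: K_def hopf_base)
  have fst1: "cmod (fst (g x)) = 1" if "x \<in> K" for x
    using that snd0[of x] g(2)[of x] by (auto simp: K_def norm_prod_def)
  have KL: "L = (\<lambda>x. {x, - x}) ` K"
    by (auto simp: K_def L_def F_def topspace_RP3)
  have L: "topspace (subtopology RP3 L) = L" by (auto simp: L_def)
  \<comment> \<open>The hypothesis gives logarithms on \<open>L\<close>, the image of
    \<open>K\<close> in \<open>RP3\<close>, so \<open>w\<close> must be even in order to descend.
    The logarithm is then pulled back to \<open>K\<close> and extended there.\<close>
  have extension: "\<exists>\<Phi>. continuous_on ?S \<Phi> \<and> (\<forall>x. \<Phi> (- x) = \<Phi> x) \<and> (\<forall>x\<in>K. w x = cis (\<Phi> x))"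
    if w: "continuous_on ?S w" "\<And>x. x \<in> ?S \<Longrightarrow> w (- x) = w x" "\<And>x. x \<in> K \<Longrightarrow> cmod (w x) = 1" for w
  proof -
    obtain v where v: "continuous_map RP3 euclidean v" "\<And>x. x \<in> ?S \<Longrightarrow> v {x, - x} = w x"
      using even_function_descends[OF w(1,2)] by blast
    have "continuous_map (subtopology RP3 L) euclidean v"
      using v(1) by (rule continuous_map_from_subtopology)
    moreover have "cmod (v A) = 1" if "A \<in> L" for A
      using that v(2) w(3) by (auto simp: KL K_def)
    ultimately obtain \<phi> where \<phi>: "continuous_map (subtopology RP3 L) euclideanreal \<phi>"
      "\<And>A. A \<in> L \<Longrightarrow> v A = cis (\<phi> A)"
      using circle_log_of_cech_rank_0[of "subtopology RP3 L" v] rank unfolding L L_def[symmetric] by blast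
    have "continuous_map S3 RP3 (\<lambda>x. {x, - x})"
      using continuous_map_RP3_iff[of RP3 id] by simp
    then have "continuous_map (top_of_set K) (subtopology RP3 L) (\<lambda>x. {x, - x})"
      using continuous_map_from_subtopology[of S3 RP3 "\<lambda>x. {x, - x}" K]
      by (auto simp: continuous_map_in_subtopology subtopology_subtopology KL K_def Int_absorb1 Int_def)
    then have "continuous_map (top_of_set K) euclideanreal (\<phi> \<circ> (\<lambda>x. {x, - x}))"
      using \<phi>(1) by (rule continuous_map_compose)
    then have "continuous_on K (\<lambda>x. \<phi> {x, - x})" by (simp add: o_def)
    then obtain \<Psi> where \<Psi>: "continuous_on UNIV \<Psi>" "\<And>x. x \<in> K \<Longrightarrow> \<Psi> x = \<phi> {x, - x}"
      using Tietze_real[OF \<open>closed K\<close>] by blast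
    \<comment> \<open>Averaging over antipodes makes the extension even and does not change it on
      \<open>K\<close>, where it comes from a function of \<open>{x, - x}\<close>.\<close>
    define \<Phi> where "\<Phi> x = (\<Psi> x + \<Psi> (- x)) / 2" for x
    have "continuous_on ?S \<Phi>"
      unfolding \<Phi>_def
      by (intro continuous_intros continuous_on_compose2[OF \<Psi>(1)]) auto
    moreover have "w x = cis (\<Phi> x)" if x: "x \<in> K" for x
    proof -
      have "- x \<in> K" using x Feven by (simp add: K_def)
      then have "\<Phi> x = \<phi> {x, - x}"
        using x \<Psi>(2) by (simp add: \<Phi>_def insert_commute)
      moreover have "v {x, - x} = w x" using x v(2) by (simp add: K_def)
      ultimately show ?thesis using \<phi>(2)[of "{x, - x}"] x by (simp add: KL)
    qed
    ultimately show ?thesis by (intro exI[of _ \<Phi>]) (simp add: \<Phi>_def add.commute)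
  qed
  show ?thesis
  proof (rule disjE[OF parity])
    assume even: "\<forall>x\<in>?S. g (- x) = g x"
    obtain \<Phi> where \<Phi>: "continuous_on ?S \<Phi>" "\<forall>x. \<Phi> (- x) = \<Phi> x" "\<forall>x\<in>K. fst (g x) = cis (\<Phi> x)"
      using extension[of "\<lambda>x. fst (g x)"] even fst1 continuous_on_fst[OF g(1)] by auto
    \<comment> \<open>Since \<open>g\<close> and its angle are both even, they descend and the
      argument for the sphere runs on \<open>RP3\<close> itself.\<close>
    obtain g' where g': "continuous_map RP3 euclidean g'" "\<And>x. x \<in> ?S \<Longrightarrow> g' {x, - x} = g x"
      using even_function_descends[OF g(1)] even by blast
    obtain \<Phi>' where \<Phi>': "continuous_map RP3 euclidean \<Phi>'" "\<And>x. x \<in> ?S \<Longrightarrow> \<Phi>' {x, - x} = \<Phi> x"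
      using even_function_descends[OF \<Phi>(1)] \<Phi>(2) by blast
    show ?thesis
    proof (rule null_homotopic_hopf[where g = g' and \<phi> = \<Phi>'])
      show "continuous_map RP3 S3 g'"
        using g' g(2) by (auto simp: continuous_map_in_subtopology topspace_RP3)
    qed (use g g' \<Phi> \<Phi>' snd0 in \<open>auto simp: topspace_RP3 F_def\<close>)
  next
    assume odd: "\<forall>x\<in>?S. g (- x) = - g x"
    obtain \<Phi> where \<Phi>: "continuous_on ?S \<Phi>" "\<forall>x. \<Phi> (- x) = \<Phi> x" "\<forall>x\<in>K. (fst (g x))\<^sup>2 = cis (\<Phi> x)"
      using extension[of "\<lambda>x. (fst (g x))\<^sup>2"] odd fst1 continuous_on_power[OF continuous_on_fst[OF g(1)]]
      by (auto simp: norm_power)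
    have False
      by (rule no_odd_lift[OF g(1,2) _ \<Phi>(1)]) (use odd \<Phi> snd0 in auto)
    then show ?thesis ..
  qed
qed

theorem theorem4p3:
  "(\<forall>f. continuous_map S3 S2 f \<and> \<not> null_homotopic S3 S2 f \<longrightarrow>
        1 \<le> ab_rank (cech_cohomology 1 (subtopology S3 {x \<in> topspace S3. f x = hopf (1, 0)}))) \<and>
   (\<forall>f. continuous_map RP3 S2 f \<and> \<not> null_homotopic RP3 S2 f \<longrightarrow>
        1 \<le> ab_rank (cech_cohomology 1 (subtopology RP3 {x \<in> topspace RP3. f x = hopf (1, 0)})))"
  using null_homotopic_S3 null_homotopic_RP3 by blast

end
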